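(* Let $S$ be the simple random walk on $\mathbb{Z}$ and let $x,y,z\in\mathbb{Z}$ with $y\ne z$. Then there exists $\varepsilon\in(0,1)$ such that, as $t\to\infty$: (i) if $x<y<z$ or $z<y<x$: $1-H_{x,y,z}(t)\sim\frac{\sqrt2\,|y-x|}{\sqrt{a\pi}\sqrt t}$; (ii) if $x=y$: $1-\frac{1}{2|y-z|}-H_{y,y,z}(t)\sim\frac{1}{\sqrt{2a\pi}\sqrt t}$; (iii) if $z<x<y$ or $y<x<z$: $\frac{x-z}{y-z}-H_{x,y,z}(t)=o(e^{-a\varepsilon t})$; (iv) if $x=z$: $\frac{1}{2|y-z|}-H_{z,y,z}(t)=o(e^{-a\varepsilon t})$; (v) if $x<z<y$ or $y<z<x$: $H_{x,y,z}(t)=0$ for all $t\ge0$.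
   Context: The simple random walk on $\mathbb{Z}$ is the continuous-time Markov chain $S=\{S(t),t\ge0\}$ on $\mathbb{Z}$ (right-continuous version) that stays at its current state an exponential time with parameter $a>0$, then jumps to each of the two neighbours with probability $1/2$, independently of the past. Let $\tau=\inf\{t\ge0:S(t)\ne S(0)\}$. For $y\ne z$, $\tau_{y,z}=\inf\{t\ge\tau:S(t)=y,\ S(u)\ne z\ \forall u\in[\tau,t]\}$ ($\inf\emptyset=\infty$) and $H_{x,y,z}(t)=\mathsf P(\tau_{y,z}\le t\mid S(0)=x)$, $t\ge0$. *)

theory Defs
  imports "HOL-Probability.Probability" "HOL-Library.Landau_Symbols"
begin

text \<open>Construction of the continuous-time simple random walk started at x from
holding times E k (jump k+1 occurs at time E 0 + ... + E k) and steps xi k.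
The position at time t (right-continuous) is x plus the sum of the first N(t) steps,
where N(t) is the number of jump times in (0,t].\<close>

definition srw_pos :: "int \<Rightarrow> (nat \<Rightarrow> 'a \<Rightarrow> real) \<Rightarrow> (nat \<Rightarrow> 'a \<Rightarrow> int) \<Rightarrow> real \<Rightarrow> 'a \<Rightarrow> int" where
  "srw_pos x E xi t \<omega> =
     x + (\<Sum>k < card {n::nat. 1 \<le> n \<and> (\<Sum>j<n. E j \<omega>) \<le> t}. xi k \<omega>)"

definition first_jump :: "(real \<Rightarrow> 'a \<Rightarrow> int) \<Rightarrow> 'a \<Rightarrow> ereal" where
  "first_jump S \<omega> = Inf {ereal t | t. 0 \<le> t \<and> S t \<omega> \<noteq> S 0 \<omega>}"

definition hit_time :: "(real \<Rightarrow> 'a \<Rightarrow> int) \<Rightarrow> int \<Rightarrow> int \<Rightarrow> 'a \<Rightarrow> ereal" where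
  "hit_time S y z \<omega> = Inf {ereal t | t. first_jump S \<omega> \<le> ereal t \<and> S t \<omega> = y \<and>
       (\<forall>u. first_jump S \<omega> \<le> ereal u \<and> u \<le> t \<longrightarrow> S u \<omega> \<noteq> z)}"

text \<open>H_{x,y,z}(t) = P(tau_{y,z} <= t | S(0) = x), for the walk started at x.\<close>
definition H_fun :: "'a measure \<Rightarrow> (real \<Rightarrow> 'a \<Rightarrow> int) \<Rightarrow> int \<Rightarrow> int \<Rightarrow> real \<Rightarrow> real" where
  "H_fun M S y z t = measure M {\<omega> \<in> space M. hit_time S y z \<omega> \<le> ereal t}"

end

theory Submission
  imports Defs
begin

text \<open>
  At time \<open>t\<close> the walk has made a Poisson number of jumps with mean \<open>a t\<close>, independent of the steps,
  so \<open>H t\<close> is the Poisson average of the probabilities that the embedded discrete walk reaches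
  \<open>y\<close> before \<open>z\<close> within \<open>k\<close> steps. Between \<open>z\<close> and \<open>y\<close> the discrete error decays geometrically,
  because \<open>(x - z) (y - x)\<close> is a supersolution of the walk killed at both ends. Away from \<open>z\<close>
  the reflection principle gives the discrete tail as a sum of binomial coefficients, of order
  \<open>k\<^sup>-\<^sup>1\<^sup>/\<^sup>2\<close> by Wallis' product. Poisson averaging turns a geometric tail into an exponential one
  and preserves the square-root tail.

  Since \<open>H\<close> is defined through \<open>measure\<close>, which is \<open>0\<close> on non-measurable sets, the hitting event has
  to be shown measurable also on the null set of degenerate paths.
\<close>

section \<open>Measurability of the hitting time\<close>

text \<open>The hitting time only looks at the path from the first jump on, so a start at
  \<open>y\<close> or at \<open>z\<close> is not itself a visit. Hence two discrete probabilities: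
  \<open>return_prob\<close> makes one free step and then continues with \<open>hit_prob\<close>.
  This explains cases (ii) and (iv). From \<open>y\<close>, half of the mass steps to the side away
  from \<open>z\<close>, which produces the square-root tail, and half steps towards
  \<open>z\<close>, where the error is geometric. From \<open>z\<close>, half of the mass steps to
  the wrong side and cannot reach \<open>y\<close> without crossing \<open>z\<close>. The constant
  in (i) is the discrete tail \<open>d * sqrt (2 / pi) / sqrt k\<close> at the mean number
  \<open>k = a * t\<close> of jumps; (ii) has half of it with \<open>d = 1\<close>. Replacing
  \<open>k\<close> by its mean needs no concentration estimate: \<open>1 / sqrt (k + 1)\<close> is
  squeezed between functions of \<open>k\<close> with closed-form Poisson averages. Averaging turns
  \<open>q ^ k\<close> into \<open>exp (- a * t * (1 - q))\<close>. With
  \<open>q = 1 - 1 / (2 * m ^ 2)\<close> and \<open>m\<close> the distance of \<open>y\<close> and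
  \<open>z\<close>, every exponent below \<open>1 / (2 * m ^ 2)\<close> is admissible; the witness
  is half of it.\<close>

text \<open>Both infima run over uncountably many times. Since the path is constant from some
  candidate \<open>d i\<close> up to \<open>t\<close>, an admissible time can be moved back to a
  candidate, and countable infima suffice. Nothing else is assumed about the paths, so degenerate
  ones are covered.\<close>

lemma measurable_hit_time:
  fixes S :: "real \<Rightarrow> 'a \<Rightarrow> int" and d :: "'i::countable \<Rightarrow> 'a \<Rightarrow> real"
  assumes S: "\<And>R. R \<in> borel_measurable M \<Longrightarrow> (\<lambda>\<omega>. S (R \<omega>) \<omega>) \<in> measurable M (count_space UNIV)"
    and d[measurable]: "\<And>i. d i \<in> borel_measurable M"
    and d_nonneg: "\<And>i \<omega>. 0 \<le> d i \<omega>"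
    and const: "\<And>t \<omega>. 0 \<le> t \<Longrightarrow> \<exists>i. d i \<omega> \<le> t \<and> (\<forall>u. d i \<omega> \<le> u \<and> u \<le> t \<longrightarrow> S u \<omega> = S t \<omega>)"
  shows "hit_time S y z \<in> borel_measurable M"
proof -
  note [measurable] = S
  let ?\<tau> = "first_jump S"
  have fj: "?\<tau> \<omega> = (INF i. if S (d i \<omega>) \<omega> \<noteq> S 0 \<omega> then ereal (d i \<omega>) else \<infinity>)" for \<omega>
  proof (rule antisym)
    show "?\<tau> \<omega> \<le> (INF i. if S (d i \<omega>) \<omega> \<noteq> S 0 \<omega> then ereal (d i \<omega>) else \<infinity>)"
      unfolding first_jump_def
    proof (rule INF_greatest)
      fix i
      show "Inf {ereal t |t. 0 \<le> t \<and> S t \<omega> \<noteq> S 0 \<omega>}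
          \<le> (if S (d i \<omega>) \<omega> \<noteq> S 0 \<omega> then ereal (d i \<omega>) else \<infinity>)"
        using d_nonneg[of i \<omega>] by (cases "S (d i \<omega>) \<omega> \<noteq> S 0 \<omega>") (auto intro!: Inf_lower)
    qed
    show "(INF i. if S (d i \<omega>) \<omega> \<noteq> S 0 \<omega> then ereal (d i \<omega>) else \<infinity>) \<le> ?\<tau> \<omega>"
      unfolding first_jump_def
    proof (rule Inf_greatest, clarify)
      fix t :: real assume t: "0 \<le> t" "S t \<omega> \<noteq> S 0 \<omega>"
      obtain i where i: "d i \<omega> \<le> t" "\<forall>u. d i \<omega> \<le> u \<and> u \<le> t \<longrightarrow> S u \<omega> = S t \<omega>"
        using const[OF t(1), of \<omega>] by blast
      have "S (d i \<omega>) \<omega> = S t \<omega>" using i by blast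
      then have "S (d i \<omega>) \<omega> \<noteq> S 0 \<omega>" using t by simp
      then show "(INF i. if S (d i \<omega>) \<omega> \<noteq> S 0 \<omega> then ereal (d i \<omega>) else \<infinity>) \<le> ereal t"
        using i(1) by (intro INF_lower2[of i]) auto
    qed
  qed
  have \<tau>[measurable]: "?\<tau> \<in> borel_measurable M"
    unfolding fj[abs_def] by measurable
  have \<tau>0: "0 \<le> ?\<tau> \<omega>" for \<omega>
    unfolding first_jump_def by (auto intro!: Inf_greatest)
  \<comment> \<open>Candidates are pushed up to the first jump, since only later times count;
    constancy up to \<open>t\<close> survives this. For an infinite first jump
    \<open>real_of_ereal\<close> gives the default 0, which is why \<open>?P\<close> excludes that
    case explicitly.\<close>
  define d' where "d' i \<omega> = max (d i \<omega>) (real_of_ereal (?\<tau> \<omega>))" for i \<omega>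
  have [measurable]: "d' i \<in> borel_measurable M" for i
    unfolding d'_def by measurable
  let ?P = "\<lambda>i \<omega>. ?\<tau> \<omega> \<noteq> \<infinity> \<and> S (d' i \<omega>) \<omega> = y \<and> (\<forall>j. d' j \<omega> \<le> d' i \<omega> \<longrightarrow> S (d' j \<omega>) \<omega> \<noteq> z)"
  have ht: "hit_time S y z \<omega> = (INF i. if ?P i \<omega> then ereal (d' i \<omega>) else \<infinity>)" for \<omega>
  proof (cases "?\<tau> \<omega> = \<infinity>")
    case True
    then show ?thesis by (simp add: hit_time_def top_ereal_def)
  next
    case False
    then obtain r where r: "?\<tau> \<omega> = ereal r" "0 \<le> r"
      using \<tau>0[of \<omega>] by (cases "?\<tau> \<omega>") auto
    have d'_ge: "r \<le> d' i \<omega>" for i by (simp add: d'_def r)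
    have const': "\<exists>i. d' i \<omega> \<le> t \<and> (\<forall>u. d' i \<omega> \<le> u \<and> u \<le> t \<longrightarrow> S u \<omega> = S t \<omega>)" if "r \<le> t" for t
    proof -
      have "0 \<le> t" using r that by simp
      from const[OF this, of \<omega>] obtain i where
        i: "d i \<omega> \<le> t" "\<And>u. d i \<omega> \<le> u \<Longrightarrow> u \<le> t \<Longrightarrow> S u \<omega> = S t \<omega>" by blast
      show ?thesis
      proof (intro exI[of _ i] conjI allI impI)
        show "d' i \<omega> \<le> t" using i(1) that by (simp add: d'_def r)
        fix u assume "d' i \<omega> \<le> u \<and> u \<le> t"
        then show "S u \<omega> = S t \<omega>" by (intro i(2)) (auto simp: d'_def)
      qed
    qed
    have "hit_time S y z \<omega> = Inf {ereal t |t. r \<le> t \<and> S t \<omega> = y \<and> (\<forall>u. r \<le> u \<and> u \<le> t \<longrightarrow> S u \<omega> \<noteq> z)}"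
      by (simp add: hit_time_def r)
    also have "\<dots> = (INF i. if ?P i \<omega> then ereal (d' i \<omega>) else \<infinity>)"
    proof (rule antisym)
      show "Inf {ereal t |t. r \<le> t \<and> S t \<omega> = y \<and> (\<forall>u. r \<le> u \<and> u \<le> t \<longrightarrow> S u \<omega> \<noteq> z)}
         \<le> (INF i. if ?P i \<omega> then ereal (d' i \<omega>) else \<infinity>)"
      proof (rule INF_greatest)
        fix i
        have "S u \<omega> \<noteq> z" if P: "?P i \<omega>" and u: "r \<le> u" "u \<le> d' i \<omega>" for u
        proof -
          obtain j where j: "d' j \<omega> \<le> u" "\<forall>v. d' j \<omega> \<le> v \<and> v \<le> u \<longrightarrow> S v \<omega> = S u \<omega>"
            using const'[OF u(1)] by blast
          then have "S (d' j \<omega>) \<omega> = S u \<omega>" by blast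
          moreover have "S (d' j \<omega>) \<omega> \<noteq> z" using P order_trans[OF j(1) u(2)] by blast
          ultimately show ?thesis by simp
        qed
        then show "Inf {ereal t |t. r \<le> t \<and> S t \<omega> = y \<and> (\<forall>u. r \<le> u \<and> u \<le> t \<longrightarrow> S u \<omega> \<noteq> z)}
            \<le> (if ?P i \<omega> then ereal (d' i \<omega>) else \<infinity>)"
          using d'_ge[of i] by (cases "?P i \<omega>") (auto intro!: Inf_lower)
      qed
      show "(INF i. if ?P i \<omega> then ereal (d' i \<omega>) else \<infinity>) \<le>
        Inf {ereal t |t. r \<le> t \<and> S t \<omega> = y \<and> (\<forall>u. r \<le> u \<and> u \<le> t \<longrightarrow> S u \<omega> \<noteq> z)}"
      proof (rule Inf_greatest, clarify)
        fix t assume t: "r \<le> t" "\<forall>u. r \<le> u \<and> u \<le> t \<longrightarrow> S u \<omega> \<noteq> z" "y = S t \<omega>"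
        obtain i where i: "d' i \<omega> \<le> t" "\<forall>u. d' i \<omega> \<le> u \<and> u \<le> t \<longrightarrow> S u \<omega> = S t \<omega>"
          using const'[OF t(1)] by blast
        have eq: "S (d' i \<omega>) \<omega> = S t \<omega>" using i by blast
        have "?\<tau> \<omega> \<noteq> \<infinity> \<and> S (d' i \<omega>) \<omega> = S t \<omega> \<and> (\<forall>j. d' j \<omega> \<le> d' i \<omega> \<longrightarrow> S (d' j \<omega>) \<omega> \<noteq> z)"
        proof (intro conjI allI impI)
          fix j assume "d' j \<omega> \<le> d' i \<omega>"
          then show "S (d' j \<omega>) \<omega> \<noteq> z" using t(2) order_trans[OF _ i(1)] d'_ge[of j] by blast
        qed (use False eq in auto)
        then show "(INF i. if ?\<tau> \<omega> \<noteq> \<infinity> \<and> S (d' i \<omega>) \<omega> = S t \<omega> \<and>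
             (\<forall>j. d' j \<omega> \<le> d' i \<omega> \<longrightarrow> S (d' j \<omega>) \<omega> \<noteq> z) then ereal (d' i \<omega>) else \<infinity>) \<le> ereal t"
          using i(1) by (intro INF_lower2[of i]) auto
      qed
    qed
    finally show ?thesis .
  qed
  show ?thesis unfolding ht[abs_def] by measurable
qed

text \<open>Past the lower limit \<open>L\<close> of the jump times infinitely many of them have occurred, and the
  cardinality is the junk value \<open>0\<close>. Hence the times \<open>L + 1 / n\<close> are needed besides the jump times; since
  \<open>1 / 0 = 0\<close> they include \<open>L\<close> itself.\<close>

lemma card_jumps_constant_since:
  fixes T :: "nat \<Rightarrow> real"
  defines "N \<equiv> \<lambda>t. card {n. 1 \<le> n \<and> T n \<le> t}"
    and "L \<equiv> liminf (\<lambda>n. ereal (T n))"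
  assumes "T 0 = 0" "0 \<le> t"
  shows "\<exists>s. (s \<in> range (\<lambda>n. max 0 (T n)) \<or> s \<in> range (\<lambda>n. max 0 (real_of_ereal L + 1 / real n)))
    \<and> s \<le> t \<and> (\<forall>u. s \<le> u \<and> u \<le> t \<longrightarrow> N u = N t)"
proof -
  have zero: "N u = 0" if "L < ereal u" for u
  proof -
    have "infinite {n. 1 \<le> n \<and> T n \<le> u}"
    proof
      assume "finite {n. 1 \<le> n \<and> T n \<le> u}"
      then have "eventually (\<lambda>n. n \<notin> {n. 1 \<le> n \<and> T n \<le> u}) sequentially"
        unfolding cofinite_eq_sequentially[symmetric] eventually_cofinite by simp
      then have "eventually (\<lambda>n. ereal u \<le> ereal (T n)) sequentially"
        using eventually_ge_at_top[of 1] by eventually_elim auto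
      then have "ereal u \<le> L" unfolding L_def by (rule Liminf_bounded)
      with that show False by simp
    qed
    then show ?thesis by (simp add: N_def)
  qed
  consider "ereal t < L" | "L = ereal t" | "L < ereal t" by fastforce
  then show ?thesis
  proof cases
    case 1
    then have "eventually (\<lambda>n. ereal t < ereal (T n)) sequentially"
      unfolding L_def by (rule less_LiminfD)
    then have fin: "finite {n. T n \<le> t}"
      unfolding cofinite_eq_sequentially[symmetric] eventually_cofinite by (simp add: not_less)
    let ?F = "insert 0 {n. T n \<le> t}"
    \<comment> \<open>\<open>T\<close> is not assumed monotone (holding times may be negative on a
      null set), so the last jump up to \<open>t\<close> is found as the largest value, not at the
      largest index.\<close>
    define s where "s = Max (T ` ?F)"
    have s: "s \<in> T ` ?F" unfolding s_def using fin by (intro Max_in) auto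
    have s0: "0 \<le> s" unfolding s_def using fin assms by (intro Max_ge) (auto simp: image_iff)
    have le: "T n \<le> s" if "T n \<le> t" for n
      unfolding s_def using fin that by (intro Max_ge) auto
    have "s \<le> t" using s assms by auto
    have "N u = N t" if "s \<le> u" "u \<le> t" for u
    proof -
      have "{n. 1 \<le> n \<and> T n \<le> u} = {n. 1 \<le> n \<and> T n \<le> t}"
        using that le by force
      then show ?thesis by (simp add: N_def)
    qed
    moreover have "s \<in> range (\<lambda>n. max 0 (T n))" using s s0 by (auto simp: image_iff max_def)
    ultimately show ?thesis using \<open>s \<le> t\<close> by blast
  next
    case 2
    then have "t = max 0 (real_of_ereal L + 1 / real 0)" using assms by simp
    then show ?thesis by (metis antisym order_refl rangeI)
  next
    case 3
    show ?thesis
    proof (cases L)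
      case (real r)
      then have "0 < t - r" using 3 by simp
      then obtain n where n: "n \<noteq> 0" "inverse (real n) < t - r"
        using real_arch_inverse[of "t - r"] by auto
      define s where "s = max 0 (real_of_ereal L + 1 / real n)"
      have "r < r + 1 / real n" using n by simp
      moreover have "r + 1 / real n < t" using n by (simp add: inverse_eq_divide)
      ultimately have "r < s" "s \<le> t"
        unfolding s_def real real_of_ereal.simps using assms(4) by linarith+
      then have "N u = N t" if "s \<le> u" for u
        using zero[of u] zero[OF 3] that real by auto
      then show ?thesis using \<open>s \<le> t\<close> unfolding s_def by blast
    next
      case PInf
      then show ?thesis using 3 by simp
    next
      case MInf
      then have N: "N u = N t" for u using zero[of u] zero[of t] by simp
      have "max 0 (T 0) = 0" using assms(3) by simp
      then have "0 \<in> range (\<lambda>n. max 0 (T n))" by (metis rangeI)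
      then show ?thesis
      proof (intro exI[of _ 0] conjI disjI1 allI impI)
        show "0 \<le> t" by (rule assms(4))
        show "N u = N t" for u by (rule N)
      qed
    qed
  qed
qed

lemma measurable_walk:
  fixes xi :: "nat \<Rightarrow> 'a \<Rightarrow> int"
  assumes "\<And>k. xi k \<in> measurable M (count_space UNIV)"
  shows "(\<lambda>\<omega>. x + (\<Sum>k<n. xi k \<omega>)) \<in> measurable M (count_space UNIV)"
proof (induction n)
  case (Suc n)
  have "(\<lambda>\<omega>. (x + (\<Sum>k<n. xi k \<omega>)) + xi n \<omega>) \<in> measurable M (count_space UNIV)"
    by (rule measurable_compose_countable[where f = "\<lambda>k \<omega>. (x + (\<Sum>k<n. xi k \<omega>)) + k", OF _ assms])
       (rule measurable_compose[OF Suc], simp)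
  then show ?case by (simp add: add.assoc)
qed simp

lemma measurable_srw_hit_time:
  assumes [measurable]: "\<And>k. E k \<in> borel_measurable M" "\<And>k. xi k \<in> measurable M (count_space UNIV)"
  shows "hit_time (srw_pos x E xi) y z \<in> borel_measurable M"
proof -
  let ?T = "\<lambda>n \<omega>. \<Sum>j<n. E j \<omega>"
  let ?L = "\<lambda>\<omega>. liminf (\<lambda>n. ereal (?T n \<omega>))"
  define d where "d i \<omega> = (case i of Inl n \<Rightarrow> max 0 (?T n \<omega>)
      | Inr n \<Rightarrow> max 0 (real_of_ereal (?L \<omega>) + 1 / real n))" for i :: "nat + nat" and \<omega>
  note sum_meas = measurable_walk[OF assms(2), of x]
  show ?thesis
  proof (rule measurable_hit_time[where d = d])
    fix R :: "'a \<Rightarrow> real" assume [measurable]: "R \<in> borel_measurable M"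
    have "(\<lambda>\<omega>. card {n::nat. 1 \<le> n \<and> ?T n \<omega> \<le> R \<omega>}) \<in> measurable M (count_space UNIV)"
      by (rule measurable_card) simp
    then show "(\<lambda>\<omega>. srw_pos x E xi (R \<omega>) \<omega>) \<in> measurable M (count_space UNIV)"
      unfolding srw_pos_def by (rule measurable_compose_countable[OF sum_meas])
  next
    show "d i \<in> borel_measurable M" for i
      unfolding d_def by (cases i) simp_all
    show "0 \<le> d i \<omega>" for i \<omega> by (auto simp: d_def split: sum.split)
    fix t :: real and \<omega> assume t: "0 \<le> t"
    from card_jumps_constant_since[OF _ t, of "\<lambda>n. ?T n \<omega>"]
    obtain s where s: "s \<in> range (\<lambda>n. max 0 (?T n \<omega>)) \<or> s \<in> range (\<lambda>n. max 0 (real_of_ereal (?L \<omega>) + 1 / real n))"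
      "s \<le> t" "\<forall>u. s \<le> u \<and> u \<le> t \<longrightarrow>
         card {n. 1 \<le> n \<and> ?T n \<omega> \<le> u} = card {n. 1 \<le> n \<and> ?T n \<omega> \<le> t}" by auto
    from s(1) obtain i where "s = d i \<omega>"
    proof (elim disjE imageE)
      fix n assume "s = max 0 (?T n \<omega>)"
      then have "s = d (Inl n) \<omega>" by (simp add: d_def)
      then show thesis by (rule that)
    next
      fix n assume "s = max 0 (real_of_ereal (?L \<omega>) + 1 / real n)"
      then have "s = d (Inr n) \<omega>" by (simp add: d_def)
      then show thesis by (rule that)
    qed
    then show "\<exists>i. d i \<omega> \<le> t \<and> (\<forall>u. d i \<omega> \<le> u \<and> u \<le> t \<longrightarrow> srw_pos x E xi u \<omega> = srw_pos x E xi t \<omega>)"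
    proof (intro exI[of _ i] conjI allI impI)
      show "d i \<omega> \<le> t" using \<open>s = d i \<omega>\<close> s(2) by simp
      fix u assume "d i \<omega> \<le> u \<and> u \<le> t"
      then have "card {n. 1 \<le> n \<and> ?T n \<omega> \<le> u} = card {n. 1 \<le> n \<and> ?T n \<omega> \<le> t}"
        using \<open>s = d i \<omega>\<close> s(3) by blast
      then show "srw_pos x E xi u \<omega> = srw_pos x E xi t \<omega>" unfolding srw_pos_def by (rule arg_cong)
    qed
  qed
qed

section \<open>The embedded discrete walk\<close>

text \<open>Both index ranges begin at 1, mirroring that the hitting time ignores the path before
  the first jump: starting at \<open>y\<close> is no success and starting at \<open>z\<close> no
  failure.\<close>

definition walk_hits :: "int \<Rightarrow> int \<Rightarrow> int \<Rightarrow> (nat \<Rightarrow> int) \<Rightarrow> nat \<Rightarrow> bool" where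
  "walk_hits y z x f k \<longleftrightarrow>
     (\<exists>n\<in>{1..k}. x + (\<Sum>i<n. f i) = y \<and> (\<forall>j\<in>{1..n}. x + (\<Sum>i<j. f i) \<noteq> z))"

lemma card_jumps_eq:
  fixes T :: "nat \<Rightarrow> real"
  assumes "strict_mono T" "T k \<le> s" "s < T (Suc k)"
  shows "card {n. 1 \<le> n \<and> T n \<le> s} = k"
proof -
  have "{n. 1 \<le> n \<and> T n \<le> s} = {1..k}"
  proof safe
    fix n assume n: "1 \<le> n" "T n \<le> s"
    have "T n < T (Suc k)" using n assms by simp
    then have "n < Suc k" using strict_mono_less[OF assms(1)] by blast
    with n show "n \<in> {1..k}" by simp
  next
    fix n assume n: "n \<in> {1..k}"
    then have "T n \<le> T k" using strict_mono_less_eq[OF assms(1)] by simp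
    with assms show "T n \<le> s" by simp
  qed auto
  then show ?thesis by simp
qed

lemma jump_index_exists:
  fixes T :: "nat \<Rightarrow> real"
  assumes "T 0 \<le> s" "s < T n"
  obtains k where "T k \<le> s" "s < T (Suc k)"
proof -
  define m where "m = (LEAST n. s < T n)"
  have m: "s < T m" unfolding m_def using assms(2) by (rule LeastI)
  then have "m \<noteq> 0" using assms(1) by (metis not_le)
  then obtain k where k: "m = Suc k" by (cases m) auto
  then have "\<not> s < T k" unfolding m_def by (intro not_less_Least) simp
  then show thesis using m k by (intro that[of k]) auto
qed

text \<open>On a nondegenerate path the position is constant between consecutive jump times and
  equals the embedded walk there. What happens up to time \<open>t\<close> is therefore decided by
  the first \<open>k\<close> positions of that walk.\<close>

lemma hit_time_le_iff_walk_hits: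
  assumes mono: "strict_mono (\<lambda>n. \<Sum>j<n. E j \<omega>)"
    and unbounded: "\<And>s. \<exists>n. s < (\<Sum>j<n. E j \<omega>)"
    and step: "\<And>k. xi k \<omega> \<noteq> 0"
    and k: "(\<Sum>j<k. E j \<omega>) \<le> t" "t < (\<Sum>j<Suc k. E j \<omega>)"
  shows "hit_time (srw_pos x E xi) y z \<omega> \<le> ereal t \<longleftrightarrow> walk_hits y z x (\<lambda>j. xi j \<omega>) k"
proof -
  define T where "T n = (\<Sum>j<n. E j \<omega>)" for n
  define W where "W n = x + (\<Sum>j<n. xi j \<omega>)" for n
  let ?S = "srw_pos x E xi"
  have T: "strict_mono T" using mono unfolding T_def[abs_def] .
  have T_mono: "m \<le> n \<Longrightarrow> T m \<le> T n" for m n using strict_mono_less_eq[OF T] by simp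
  have T0: "T 0 = 0" by (simp add: T_def)
  have S: "?S s \<omega> = W m" if "T m \<le> s" "s < T (Suc m)" for s m
    using card_jumps_eq[OF T that] by (simp add: srw_pos_def T_def W_def)
  have S_T: "?S (T m) \<omega> = W m" for m
    using S[of m "T m"] strict_mono_less[OF T, of m "Suc m"] by simp
  have index: "\<exists>m. T m \<le> s \<and> s < T (Suc m)" if "0 \<le> s" for s
  proof -
    obtain n where "s < T n" using unbounded unfolding T_def by blast
    then show ?thesis using jump_index_exists[of T s n] that T0 by metis
  qed
  \<comment> \<open>A vanishing step would make the first change of position come later than
    \<open>T 1\<close>.\<close>
  have fj: "first_jump ?S \<omega> = ereal (T 1)"
    unfolding first_jump_def
  proof (rule antisym)
    have "?S (T 1) \<omega> \<noteq> ?S 0 \<omega>"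
      using S_T[of 1] S_T[of 0] step[of 0] by (simp add: T0 W_def)
    then show "Inf {ereal t |t. 0 \<le> t \<and> ?S t \<omega> \<noteq> ?S 0 \<omega>} \<le> ereal (T 1)"
      using T_mono[of 0 1] T0 by (intro Inf_lower) auto
    show "ereal (T 1) \<le> Inf {ereal t |t. 0 \<le> t \<and> ?S t \<omega> \<noteq> ?S 0 \<omega>}"
    proof (rule Inf_greatest, clarify)
      fix s :: real assume s: "0 \<le> s" "?S s \<omega> \<noteq> ?S 0 \<omega>"
      have "\<not> s < T 1"
      proof
        assume "s < T 1"
        then have "?S s \<omega> = W 0" using S[of 0 s] s T0 by simp
        moreover have "?S 0 \<omega> = W 0" using S_T[of 0] T0 by simp
        ultimately show False using s by simp
      qed
      then show "ereal (T 1) \<le> ereal s" by simp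
    qed
  qed
  define A where "A = {s. T 1 \<le> s \<and> ?S s \<omega> = y \<and> (\<forall>u. T 1 \<le> u \<and> u \<le> s \<longrightarrow> ?S u \<omega> \<noteq> z)}"
  have ht: "hit_time ?S y z \<omega> = Inf (ereal ` A)"
    unfolding hit_time_def fj A_def by (rule arg_cong[where f = Inf]) auto
  \<comment> \<open>An admissible time can be moved back to the jump that started its holding
    interval.\<close>
  have in_A: "T n \<in> A \<and> T n \<le> s" if s: "s \<in> A" "T n \<le> s" "s < T (Suc n)" for s n
  proof -
    have "?S s \<omega> = W n" using S s by blast
    moreover have "1 \<le> n"
      using s(1,3) strict_mono_less[OF T, of 1 "Suc n"] unfolding A_def by auto
    ultimately show ?thesis using s S_T[of n] T_mono[of 1 n] unfolding A_def by auto
  qed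
  have A_T: "T n \<in> A \<longleftrightarrow> 1 \<le> n \<and> W n = y \<and> (\<forall>j\<in>{1..n}. W j \<noteq> z)" for n
  proof
    assume "T n \<in> A"
    then have *: "T 1 \<le> T n" "?S (T n) \<omega> = y" "\<And>u. T 1 \<le> u \<Longrightarrow> u \<le> T n \<Longrightarrow> ?S u \<omega> \<noteq> z"
      unfolding A_def by auto
    have "W j \<noteq> z" if "j \<in> {1..n}" for j
      using *(3)[of "T j"] that T_mono S_T[of j] by auto
    then show "1 \<le> n \<and> W n = y \<and> (\<forall>j\<in>{1..n}. W j \<noteq> z)"
      using * S_T[of n] strict_mono_less_eq[OF T, of 1 n] by auto
  next
    assume *: "1 \<le> n \<and> W n = y \<and> (\<forall>j\<in>{1..n}. W j \<noteq> z)"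
    have "?S u \<omega> \<noteq> z" if u: "T 1 \<le> u" "u \<le> T n" for u
    proof -
      have "0 \<le> u" using u(1) T_mono[of 0 1] T0 by simp
      then obtain m where m: "T m \<le> u" "u < T (Suc m)" using index by blast
      have "T m \<le> T n" "T 1 < T (Suc m)" using m u by simp_all
      then have "m \<in> {1..n}" using strict_mono_less_eq[OF T] strict_mono_less[OF T] by simp
      then show ?thesis using S[OF m] * by simp
    qed
    then show "T n \<in> A" using * T_mono[of 1 n] S_T[of n] unfolding A_def by auto
  qed
  have k': "T k \<le> t" "t < T (Suc k)" using k by (simp_all add: T_def)
  have "Inf (ereal ` A) \<le> ereal t \<longleftrightarrow> (\<exists>n\<in>{1..k}. T n \<in> A)"
  proof
    assume "\<exists>n\<in>{1..k}. T n \<in> A"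
    then obtain n where n: "n \<le> k" "T n \<in> A" by auto
    have "T n \<le> t" using T_mono[OF n(1)] k' by simp
    then show "Inf (ereal ` A) \<le> ereal t" using n by (intro Inf_lower2[of "ereal (T n)"]) auto
  next
    assume le: "Inf (ereal ` A) \<le> ereal t"
    show "\<exists>n\<in>{1..k}. T n \<in> A"
    proof (rule ccontr)
      assume no: "\<not> (\<exists>n\<in>{1..k}. T n \<in> A)"
      \<comment> \<open>An infimum below \<open>t\<close> does not by itself give an admissible time
        below \<open>t\<close>. Here there is a gap: if no jump up to index \<open>k\<close> is
        admissible, everything admissible is at least \<open>T (Suc k)\<close>, which is strictly
        above \<open>t\<close>.\<close>
      have "ereal (T (Suc k)) \<le> Inf (ereal ` A)"
      proof (rule Inf_greatest, clarify)
        fix s assume s: "s \<in> A"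
        then have "0 \<le> s" using T_mono[of 0 1] T0 unfolding A_def by simp
        then obtain m where m: "T m \<le> s" "s < T (Suc m)" using index by blast
        have mA: "T m \<in> A" using in_A[OF s m] by simp
        then have "m \<notin> {1..k}" "1 \<le> m" using no A_T by blast+
        then have "T (Suc k) \<le> T m" by (intro T_mono) simp
        then show "ereal (T (Suc k)) \<le> ereal s" using m by simp
      qed
      from order_trans[OF this le] have "ereal (T (Suc k)) \<le> ereal t" .
      then show False using k' by simp
    qed
  qed
  also have "\<dots> \<longleftrightarrow> walk_hits y z x (\<lambda>j. xi j \<omega>) k"
    unfolding walk_hits_def A_T W_def by auto
  finally show ?thesis by (simp add: ht)
qed

section \<open>Poisson averages\<close>

definition pois :: "real \<Rightarrow> nat \<Rightarrow> real" where
  "pois \<mu> k = \<mu> ^ k / fact k * exp (- \<mu>)"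

lemma pois_nonneg: "0 \<le> \<mu> \<Longrightarrow> 0 \<le> pois \<mu> k"
  by (simp add: pois_def)

text \<open>This is the generating function of the Poisson law; it converts a geometric discrete
  rate into an exponential rate.\<close>

lemma sums_pois_power: "(\<lambda>k. pois \<mu> k * q ^ k) sums exp (- (\<mu> * (1 - q)))"
proof -
  have "(\<lambda>k. exp (- \<mu>) * ((\<mu> * q) ^ k /\<^sub>R fact k)) sums (exp (- \<mu>) * exp (\<mu> * q))"
    by (intro sums_mult exp_converges)
  also have "exp (- \<mu>) * exp (\<mu> * q) = exp (- (\<mu> * (1 - q)))"
    by (simp add: exp_add[symmetric] algebra_simps)
  also have "(\<lambda>k. exp (- \<mu>) * ((\<mu> * q) ^ k /\<^sub>R fact k)) = (\<lambda>k. pois \<mu> k * q ^ k)"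
    by (simp add: pois_def fun_eq_iff power_mult_distrib divide_inverse mult_ac)
  finally show ?thesis .
qed

lemma sums_pois: "pois \<mu> sums 1"
  using sums_pois_power[of \<mu> 1] by simp

lemma summable_pois_bounded:
  assumes "0 \<le> \<mu>" "\<And>k. \<bar>g k\<bar> \<le> C"
  shows "summable (\<lambda>k. pois \<mu> k * g k)"
proof (rule summable_comparison_test)
  show "summable (\<lambda>k. pois \<mu> k * C)"
    using sums_pois[of \<mu>] by (intro summable_mult2) (simp add: sums_iff)
  show "\<exists>N. \<forall>n\<ge>N. norm (pois \<mu> n * g n) \<le> pois \<mu> n * C"
    using assms pois_nonneg[OF assms(1)] by (auto simp: abs_mult intro!: mult_left_mono)
qed

text \<open>The factor \<open>\<mu> / (k + 1)\<close> shifts the Poisson weight from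
  \<open>k\<close> to \<open>k + 1\<close>, so only the weight at 0 is missing from the total
  mass.\<close>

lemma sums_pois_inverse_Suc:
  assumes "0 < \<mu>"
  shows "(\<lambda>k. pois \<mu> k * (\<mu> / (real k + 1))) sums (1 - exp (- \<mu>))"
proof -
  have "(\<lambda>k. pois \<mu> (Suc k)) sums (1 - pois \<mu> 0)"
    using sums_pois[of \<mu>] by (subst sums_Suc_iff) simp
  also have "(\<lambda>k. pois \<mu> (Suc k)) = (\<lambda>k. pois \<mu> k * (\<mu> / (real k + 1)))"
    by (simp add: pois_def fun_eq_iff field_simps)
  finally show ?thesis by (simp add: pois_def)
qed

lemma sums_pois_Suc:
  shows "(\<lambda>k. pois \<mu> k * (real k + 1)) sums (\<mu> + 1)"
proof -
  have "(\<lambda>k. \<mu> * pois \<mu> k) sums (\<mu> * 1)" by (intro sums_mult sums_pois)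
  also have "(\<lambda>k. \<mu> * pois \<mu> k) = (\<lambda>k. pois \<mu> (Suc k) * real (Suc k))"
    by (simp add: pois_def fun_eq_iff field_simps del: of_nat_Suc)
  finally have "(\<lambda>k. pois \<mu> k * real k) sums \<mu>"
    by (subst (asm) sums_Suc_iff) simp
  from sums_add[OF this sums_pois[of \<mu>]] show ?thesis by (simp add: algebra_simps)
qed

text \<open>With \<open>v = sqrt (\<mu> / (k + 1))\<close>, the bounds \<open>3 / 2 - 1 / (2 v\<^sup>2) \<le> v \<le> (1 + v\<^sup>2) / 2\<close> have outer sides
  whose Poisson averages are explicit.\<close>

lemma sqrt_pois_average_bounds:
  assumes "0 < \<mu>"
  defines "A \<equiv> \<Sum>k. pois \<mu> k * (1 / sqrt (real k + 1))"
  shows "1 - 1 / (2 * \<mu>) \<le> sqrt \<mu> * A" "sqrt \<mu> * A \<le> 1"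
proof -
  define v where "v k = sqrt \<mu> / sqrt (real k + 1)" for k
  have v_pos: "0 < v k" for k using assms by (simp add: v_def)
  have v2: "(v k)\<^sup>2 = \<mu> / (real k + 1)" for k using assms by (simp add: v_def power_divide)
  have lower: "3 / 2 - (real k + 1) / (2 * \<mu>) \<le> v k" for k
  proof -
    \<comment> \<open>The claimed inequality multiplied by \<open>2 * (v k)\<^sup>2\<close> is a
      cubic with a double root at 1. Both bounds touch \<open>v\<close> at 1, that is at
      \<open>k + 1 = \<mu>\<close>, which is why both averages tend to 1.\<close>
    have "0 \<le> (v k - 1)\<^sup>2 * (2 * v k + 1)" using v_pos[of k] by simp
    also have "\<dots> = 2 * (v k)^3 - 3 * (v k)\<^sup>2 + 1" by (simp add: power2_eq_square power3_eq_cube algebra_simps)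
    finally have "3 / 2 - 1 / (2 * (v k)\<^sup>2) \<le> v k"
      using v_pos[of k] by (simp add: field_simps power2_eq_square power3_eq_cube)
    then show ?thesis by (simp add: v2)
  qed
  have upper: "v k \<le> 1 / 2 + (\<mu> / (real k + 1)) / 2" for k
  proof -
    have "0 \<le> (v k - 1)\<^sup>2" by simp
    then have "v k \<le> 1 / 2 + (v k)\<^sup>2 / 2" by (simp add: power2_eq_square algebra_simps)
    then show ?thesis unfolding v2 .
  qed
  have A: "(\<lambda>k. pois \<mu> k * v k) sums (sqrt \<mu> * A)"
  proof -
    have "summable (\<lambda>k. pois \<mu> k * (1 / sqrt (real k + 1)))"
      using assms by (intro summable_pois_bounded[where C = 1]) auto
    then have "(\<lambda>k. sqrt \<mu> * (pois \<mu> k * (1 / sqrt (real k + 1)))) sums (sqrt \<mu> * A)"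
      unfolding A_def by (intro sums_mult summable_sums)
    then show ?thesis by (simp add: v_def mult_ac)
  qed
  have lo: "(\<lambda>k. pois \<mu> k * (3 / 2) - pois \<mu> k * (real k + 1) / (2 * \<mu>)) sums (1 * (3 / 2) - (\<mu> + 1) / (2 * \<mu>))"
    by (intro sums_diff sums_mult2 sums_divide sums_pois sums_pois_Suc)
  have "(1 * (3 / 2) - (\<mu> + 1) / (2 * \<mu>)) \<le> sqrt \<mu> * A"
  proof (rule sums_le[OF _ lo A])
    show "pois \<mu> k * (3 / 2) - pois \<mu> k * (real k + 1) / (2 * \<mu>) \<le> pois \<mu> k * v k" for k
      using mult_left_mono[OF lower[of k] pois_nonneg[of \<mu> k]] assms by (simp add: algebra_simps)
  qed
  then show "1 - 1 / (2 * \<mu>) \<le> sqrt \<mu> * A" using assms by (simp add: field_simps)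
  have up: "(\<lambda>k. pois \<mu> k * (1 / 2) + pois \<mu> k * (\<mu> / (real k + 1)) / 2) sums (1 * (1 / 2) + (1 - exp (- \<mu>)) / 2)"
    by (intro sums_add sums_mult2 sums_divide sums_pois sums_pois_inverse_Suc assms)
  have "sqrt \<mu> * A \<le> 1 * (1 / 2) + (1 - exp (- \<mu>)) / 2"
  proof (rule sums_le[OF _ A up])
    show "pois \<mu> k * v k \<le> pois \<mu> k * (1 / 2) + pois \<mu> k * (\<mu> / (real k + 1)) / 2" for k
      using mult_left_mono[OF upper[of k] pois_nonneg[of \<mu> k]] assms by (simp add: algebra_simps)
  qed
  also have "\<dots> \<le> 1" by (simp add: field_simps)
  finally show "sqrt \<mu> * A \<le> 1" .
qed

lemma sqrt_pois_average_tendsto: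
  "((\<lambda>\<mu>. sqrt \<mu> * (\<Sum>k. pois \<mu> k * (1 / sqrt (real k + 1)))) \<longlongrightarrow> 1) at_top"
proof (rule tendsto_sandwich)
  show "eventually (\<lambda>\<mu>::real. 1 - 1 / (2 * \<mu>) \<le> sqrt \<mu> * (\<Sum>k. pois \<mu> k * (1 / sqrt (real k + 1)))) at_top"
    using eventually_gt_at_top[of 0] by eventually_elim (rule sqrt_pois_average_bounds)
  show "eventually (\<lambda>\<mu>::real. sqrt \<mu> * (\<Sum>k. pois \<mu> k * (1 / sqrt (real k + 1))) \<le> 1) at_top"
    using eventually_gt_at_top[of 0] by eventually_elim (rule sqrt_pois_average_bounds)
  have "((\<lambda>\<mu>::real. 1 - inverse \<mu> / 2) \<longlongrightarrow> 1 - 0 / 2) at_top"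
    by (intro tendsto_intros tendsto_inverse_0_at_top filterlim_ident) simp
  then show "((\<lambda>\<mu>::real. 1 - 1 / (2 * \<mu>)) \<longlongrightarrow> 1) at_top" by (simp add: field_simps)
qed simp

lemma sqrt_pois_tendsto_0: "((\<lambda>\<mu>. sqrt \<mu> * pois \<mu> k) \<longlongrightarrow> 0) at_top"
proof (rule tendsto_sandwich)
  show "eventually (\<lambda>\<mu>::real. 0 \<le> sqrt \<mu> * pois \<mu> k) at_top"
    using eventually_ge_at_top[of 0] by eventually_elim (simp add: pois_nonneg)
  show "eventually (\<lambda>\<mu>::real. sqrt \<mu> * pois \<mu> k \<le> \<mu> ^ Suc k / exp \<mu>) at_top"
    using eventually_ge_at_top[of 1]
  proof eventually_elim
    case (elim \<mu>)
    have "\<mu> ^ k / fact k \<le> \<mu> ^ k"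
      using elim fact_ge_1[where 'a = real, of k] by (simp add: divide_le_eq mult_le_cancel_left1)
    moreover have "sqrt \<mu> \<le> \<mu>"
      using elim by (intro real_le_lsqrt) (auto simp: power2_eq_square)
    ultimately have "sqrt \<mu> * (\<mu> ^ k / fact k) \<le> \<mu> * \<mu> ^ k"
      using elim by (intro mult_mono) auto
    then show ?case by (simp add: pois_def exp_minus field_simps)
  qed
  show "((\<lambda>\<mu>::real. \<mu> ^ Suc k / exp \<mu>) \<longlongrightarrow> 0) at_top" by (rule tendsto_power_div_exp_0)
qed simp

text \<open>An Abelian argument: write \<open>g k\<close> as
  \<open>(c + \<delta> k) / sqrt (k + 1)\<close> with \<open>\<delta>\<close> tending to 0. The part
  with \<open>c\<close> is the explicit average; in the rest, large \<open>k\<close> have small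
  \<open>\<delta> k\<close>, and each fixed \<open>k\<close> has a Poisson weight that is negligible
  even against \<open>sqrt \<mu>\<close>.\<close>

lemma pois_average_asymptotics:
  assumes lim: "(\<lambda>k. g k * sqrt (real k + 1)) \<longlonglongrightarrow> c"
  shows "((\<lambda>\<mu>. sqrt \<mu> * (\<Sum>k. pois \<mu> k * g k)) \<longlongrightarrow> c) at_top"
proof -
  define \<delta> where "\<delta> k = g k * sqrt (real k + 1) - c" for k
  define w where "w k = 1 / sqrt (real k + 1)" for k
  have w: "0 \<le> w k" "w k \<le> 1" for k by (auto simp: w_def)
  have g: "g k = c * w k + \<delta> k * w k" for k
  proof -
    have "sqrt (real k + 1) \<noteq> 0" by simp
    then show ?thesis by (simp add: \<delta>_def w_def field_simps)
  qed
  have \<delta>: "\<delta> \<longlonglongrightarrow> 0" unfolding \<delta>_def[abs_def] using tendsto_diff[OF lim tendsto_const[of c]] by simp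
  then obtain D where D: "\<And>k. \<bar>\<delta> k\<bar> \<le> D"
    using convergent_imp_Bseq[of \<delta>] unfolding convergent_def Bseq_def by auto
  define A where "A \<mu> = (\<Sum>k. pois \<mu> k * w k)" for \<mu>
  define R where "R \<mu> = (\<Sum>k. pois \<mu> k * (\<delta> k * w k))" for \<mu>
  have A_lim: "((\<lambda>\<mu>. sqrt \<mu> * A \<mu>) \<longlongrightarrow> 1) at_top"
    using sqrt_pois_average_tendsto unfolding A_def w_def .
  have sum_w: "summable (\<lambda>k. pois \<mu> k * w k)" if "0 \<le> \<mu>" for \<mu>
    using w that by (intro summable_pois_bounded[where C = 1]) auto
  have bd: "\<bar>\<delta> k * w k\<bar> \<le> D" for k
    using mult_mono[OF D[of k] w(2)[of k]] w(1)[of k] D[of k] by (simp add: abs_mult)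
  have sum_\<delta>: "summable (\<lambda>k. pois \<mu> k * (\<delta> k * w k))" if "0 \<le> \<mu>" for \<mu>
    using bd that by (rule summable_pois_bounded[rotated])
  have split: "(\<Sum>k. pois \<mu> k * g k) = c * A \<mu> + R \<mu>" if "0 \<le> \<mu>" for \<mu>
  proof -
    have "(\<lambda>k. c * (pois \<mu> k * w k) + pois \<mu> k * (\<delta> k * w k)) sums (c * A \<mu> + R \<mu>)"
      unfolding A_def R_def by (intro sums_add sums_mult summable_sums sum_w sum_\<delta> that)
    also have "(\<lambda>k. c * (pois \<mu> k * w k) + pois \<mu> k * (\<delta> k * w k)) = (\<lambda>k. pois \<mu> k * g k)"
      by (simp add: g algebra_simps fun_eq_iff)
    finally show ?thesis by (simp add: sums_iff)
  qed
  have R_lim: "((\<lambda>\<mu>. sqrt \<mu> * R \<mu>) \<longlongrightarrow> 0) at_top"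
  proof (rule tendstoI)
    fix e :: real assume e: "0 < e"
    obtain K where K: "\<And>k. k \<ge> K \<Longrightarrow> \<bar>\<delta> k\<bar> < e / 2"
      using LIMSEQ_D[OF \<delta>, of "e / 2"] e by auto
    \<comment> \<open>The first summand pays for the indices from \<open>K\<close> on, the second
      for the finitely many below, where only the uniform bound \<open>D\<close> is
      available.\<close>
    let ?B = "\<lambda>\<mu>. e / 2 * (sqrt \<mu> * A \<mu>) + D * (\<Sum>k<K. sqrt \<mu> * pois \<mu> k)"
    have "(?B \<longlongrightarrow> e / 2 * 1 + D * (\<Sum>k<K. 0)) at_top"
      by (intro tendsto_intros A_lim tendsto_sum sqrt_pois_tendsto_0)
    then have "eventually (\<lambda>\<mu>. ?B \<mu> < e) at_top"
      by (rule order_tendstoD(2)) (use e in simp)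
    moreover have "eventually (\<lambda>\<mu>. \<bar>sqrt \<mu> * R \<mu>\<bar> \<le> ?B \<mu>) at_top"
      using eventually_ge_at_top[of 0]
    proof eventually_elim
      case (elim \<mu>)
      let ?f = "\<lambda>k. if k < K then pois \<mu> k * D else 0"
      have s: "(\<lambda>k. e / 2 * (pois \<mu> k * w k) + ?f k) sums (e / 2 * A \<mu> + (\<Sum>k<K. pois \<mu> k * D))"
        unfolding A_def using sums_If_finite_set[of "{..<K}" "\<lambda>k. pois \<mu> k * D"]
        by (intro sums_add sums_mult summable_sums sum_w elim) simp
      have le: "\<bar>pois \<mu> k * (\<delta> k * w k)\<bar> \<le> e / 2 * (pois \<mu> k * w k) + ?f k" for k
      proof (cases "k < K")
        case True
        have "\<bar>pois \<mu> k * (\<delta> k * w k)\<bar> \<le> pois \<mu> k * D"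
          using mult_left_mono[OF bd[of k] pois_nonneg[OF elim, of k]] pois_nonneg[OF elim, of k]
          by (simp add: abs_mult)
        moreover have "0 \<le> e / 2 * (pois \<mu> k * w k)" using e w pois_nonneg[OF elim] by simp
        ultimately show ?thesis using True by simp
      next
        case False
        then have "\<bar>\<delta> k\<bar> \<le> e / 2" using K[of k] by simp
        then have "\<bar>\<delta> k\<bar> * (pois \<mu> k * w k) \<le> e / 2 * (pois \<mu> k * w k)"
          using w pois_nonneg[OF elim] by (intro mult_right_mono) auto
        then show ?thesis using False w[of k] pois_nonneg[OF elim, of k] by (simp add: abs_mult mult_ac)
      qed
      have "\<bar>R \<mu>\<bar> \<le> e / 2 * A \<mu> + (\<Sum>k<K. pois \<mu> k * D)"
        unfolding R_def sums_unique[OF s]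
        using norm_suminf_le[OF _ sums_summable[OF s], of "\<lambda>k. pois \<mu> k * (\<delta> k * w k)"] le by simp
      then have "sqrt \<mu> * \<bar>R \<mu>\<bar> \<le> sqrt \<mu> * (e / 2 * A \<mu> + (\<Sum>k<K. pois \<mu> k * D))"
        using elim by (intro mult_left_mono) auto
      then show ?case using elim
        by (simp add: abs_mult algebra_simps sum_distrib_left sum_distrib_right)
    qed
    ultimately show "eventually (\<lambda>\<mu>. dist (sqrt \<mu> * R \<mu>) 0 < e) at_top"
      by eventually_elim simp
  qed
  have "((\<lambda>\<mu>. c * (sqrt \<mu> * A \<mu>) + sqrt \<mu> * R \<mu>) \<longlongrightarrow> c * 1 + 0) at_top"
    by (intro tendsto_intros A_lim R_lim)
  moreover have "eventually (\<lambda>\<mu>. c * (sqrt \<mu> * A \<mu>) + sqrt \<mu> * R \<mu> = sqrt \<mu> * (\<Sum>k. pois \<mu> k * g k)) at_top"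
    using eventually_ge_at_top[of 0] by eventually_elim (simp add: split distrib_left)
  ultimately show ?thesis by (simp add: tendsto_cong)
qed

lemma pois_average_geometric:
  assumes "0 \<le> \<mu>" "\<And>k. \<bar>g k\<bar> \<le> C * q ^ k"
  shows "\<bar>\<Sum>k. pois \<mu> k * g k\<bar> \<le> C * exp (- (\<mu> * (1 - q)))"
proof -
  have s: "(\<lambda>k. C * (pois \<mu> k * q ^ k)) sums (C * exp (- (\<mu> * (1 - q))))"
    by (intro sums_mult sums_pois_power)
  have "\<bar>pois \<mu> k * g k\<bar> \<le> C * (pois \<mu> k * q ^ k)" for k
    using mult_left_mono[OF assms(2)[of k] pois_nonneg[OF assms(1), of k]] pois_nonneg[OF assms(1), of k]
    by (simp add: abs_mult mult_ac)
  then show ?thesis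
    using norm_suminf_le[OF _ sums_summable[OF s], of "\<lambda>k. pois \<mu> k * g k"] sums_unique[OF s] by simp
qed

section \<open>Hitting probabilities of the discrete walk\<close>

text \<open>Time \<open>0\<close> counts as a visit in \<open>hit_prob\<close> but not in \<open>return_prob\<close>.\<close>

primrec hit_prob :: "int \<Rightarrow> int \<Rightarrow> nat \<Rightarrow> int \<Rightarrow> real" where
  "hit_prob y z 0 x = of_bool (x = y)"
| "hit_prob y z (Suc n) x = (if x = y then 1 else if x = z then 0
     else (hit_prob y z n (x - 1) + hit_prob y z n (x + 1)) / 2)"

primrec return_prob :: "int \<Rightarrow> int \<Rightarrow> nat \<Rightarrow> int \<Rightarrow> real" where
  "return_prob y z 0 x = 0"
| "return_prob y z (Suc n) x = (hit_prob y z n (x - 1) + hit_prob y z n (x + 1)) / 2"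

lemma hit_prob_return_prob:
  "hit_prob y z n x = (if x = y then 1 else if x = z \<and> n > 0 then 0 else return_prob y z n x)"
  by (cases n) auto

text \<open>The step law is symmetric. This allows the asymptotics to be proved for
  \<open>z < y\<close> only.\<close>

lemma hit_prob_reflect: "hit_prob (- y) (- z) n (- x) = hit_prob y z n x"
proof (induction n arbitrary: x)
  case (Suc n)
  have eq: "- x + 1 = - (x - 1)" "- x - 1 = - (x + 1)" by simp_all
  show ?case by (simp only: hit_prob.simps eq Suc neg_equal_iff_equal add.commute[where 'a = real])
qed simp

lemma return_prob_reflect: "return_prob (- y) (- z) n (- x) = return_prob y z n x"
proof -
  have eq: "- x + 1 = - (x - 1)" "- x - 1 = - (x + 1)" by simp_all
  show ?thesis by (cases n) (simp_all only: return_prob.simps eq hit_prob_reflect add.commute[where 'a = real])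
qed

text \<open>Unit steps cannot jump over \<open>z\<close>. Besides case (v), this disposes of the
  first step from \<open>z\<close> away from \<open>y\<close>.\<close>

lemma hit_prob_behind: "z < y \<Longrightarrow> x \<le> z \<Longrightarrow> hit_prob y z n x = 0"
  by (induction n arbitrary: x) auto

lemma return_prob_behind: "z < y \<Longrightarrow> x < z \<Longrightarrow> return_prob y z n x = 0"
  by (cases n) (auto simp: hit_prob_behind)

section \<open>Reflection principle: a single barrier\<close>

text \<open>The probability that the walk does not reach a point at distance \<open>d\<close> within \<open>n\<close> steps. By reflection
  it is the probability that the walk from \<open>0\<close> is in \<open>{-d..<d}\<close> at time \<open>n\<close>; of \<open>-i\<close> and \<open>i - 1\<close> exactly
  one has the parity of \<open>n\<close>, and it contributes the \<open>i\<close>-th summand.\<close>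

definition survival :: "nat \<Rightarrow> nat \<Rightarrow> real" where
  "survival n d = (\<Sum>i=1..d. real (n choose ((n + i) div 2))) / 2 ^ n"

lemma survival_0_right [simp]: "survival n 0 = 0"
  by (simp add: survival_def)

lemma survival_0_left: "0 < d \<Longrightarrow> survival 0 d = 1"
proof (induction d rule: nat_induct_non_zero)
  case (Suc d)
  then show ?case by (auto simp: survival_def binomial_eq_0)
qed (simp add: survival_def)

lemma survival_Suc_right:
  "survival n (Suc d) = survival n d + real (n choose ((n + Suc d) div 2)) / 2 ^ n"
  by (simp add: survival_def add_divide_distrib)

text \<open>This is the first-step recursion of the walk at distance \<open>d + 1\<close> from the
  barrier. By induction on the distance it suffices to compare increments, for which it is Pascal's
  rule.\<close>

lemma survival_Suc_left: "survival (Suc n) (Suc d) = (survival n d + survival n (d + 2)) / 2"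
proof (induction d)
  case 0
  \<comment> \<open>For even \<open>n\<close> this is Pascal's rule; for odd \<open>n\<close> the
    two middle coefficients have to be exchanged by symmetry.\<close>
  have "real (Suc n choose ((Suc n + 1) div 2)) = real (n choose ((n + 1) div 2)) + real (n choose ((n + 2) div 2))"
  proof (cases "even n")
    case True
    then obtain m where m: "n = 2 * m" by blast
    then show ?thesis by simp
  next
    case False
    then obtain m where m: "n = 2 * m + 1" by (blast elim: oddE)
    have "(Suc (2 * m) choose m) = (Suc (2 * m) choose (Suc m))"
      using binomial_symmetric[of m "Suc (2 * m)"] by simp
    then show ?thesis by (simp add: m)
  qed
  then show ?case by (simp add: survival_def numeral_2_eq_2 add_divide_distrib)
next
  case (Suc d)
  have "(Suc n + Suc (Suc d)) div 2 = Suc ((n + Suc d) div 2)" by simp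
  moreover have "(n + Suc (d + 2)) div 2 = Suc ((n + Suc d) div 2)" by simp
  ultimately have "real (Suc n choose ((Suc n + Suc (Suc d)) div 2)) =
      real (n choose ((n + Suc d) div 2)) + real (n choose ((n + Suc (d + 2)) div 2))"
    by (simp only: binomial_Suc_Suc of_nat_add)
  then have "real (Suc n choose ((Suc n + Suc (Suc d)) div 2)) / 2 ^ Suc n =
      (real (n choose ((n + Suc d) div 2)) / 2 ^ n + real (n choose ((n + Suc (d + 2)) div 2)) / 2 ^ n) / 2"
    by (simp only: power_Suc2 divide_divide_eq_left[symmetric] add_divide_distrib)
  note diff = this
  have "s' = (u + v) / 2" if "s = (a + b) / 2" "c = (e + f) / 2" "s' = s + c" "u = a + e" "v = b + f"
    for a b c e f s s' u v :: real using that by simp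
  from this[OF Suc diff survival_Suc_right survival_Suc_right survival_Suc_right]
  show ?case unfolding add_Suc .
qed

text \<open>Starting on the far side of \<open>y\<close>, the walk meets \<open>y\<close> before it
  could meet \<open>z\<close>, so this is a one-barrier problem. Both sides then obey the same
  recursion with the same boundary values.\<close>

lemma hit_prob_survival:
  assumes "y < z" "x \<le> y"
  shows "hit_prob y z n x = 1 - survival n (nat (y - x))"
  using assms(2)
proof (induction n arbitrary: x)
  case 0
  then show ?case using survival_0_left[of "nat (y - x)"] by (cases "x = y") auto
next
  case (Suc n)
  show ?case
  proof (cases "x = y")
    case False
    define d where "d = nat (y - x - 1)"
    have d: "nat (y - x) = Suc d" "nat (y - (x + 1)) = d" "nat (y - (x - 1)) = d + 2"
      using False Suc.prems by (auto simp: d_def)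
    have "hit_prob y z n (x - 1) = 1 - survival n (d + 2)" "hit_prob y z n (x + 1) = 1 - survival n d"
      using Suc.IH[of "x - 1"] Suc.IH[of "x + 1"] Suc.prems False d by auto
    then show ?thesis
      using False Suc.prems assms(1) by (simp add: d(1) survival_Suc_left field_simps)
  qed simp
qed

section \<open>Wallis' product and the square-root tail\<close>

text \<open>The partial Wallis product up to \<open>m\<close> is exactly the reciprocal of this
  expression, by the two-term recursion of the normalised central binomial coefficient.\<close>

lemma central_binomial_tendsto:
  "(\<lambda>m. (real ((2 * m) choose m) / 4 ^ m)\<^sup>2 * (2 * real m + 1)) \<longlonglongrightarrow> 2 / pi"
proof -
  define Q where "Q m = real ((2 * m) choose m) / 4 ^ m" for m
  have Q_Suc: "Q (Suc m) = Q m * (2 * real m + 1) / (2 * real m + 2)" for m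
  proof -
    have "Suc m * ((2 * Suc m) choose Suc m) = 2 * (2 * m + 1) * ((2 * m) choose m)"
    proof -
      have "Suc m * ((2 * Suc m) choose Suc m) = (2 * Suc m) * ((2 * m + 1) choose m)"
        using Suc_times_binomial_eq[of "2 * m + 1" m] by (simp add: mult.commute)
      moreover have "Suc m * ((2 * m + 1) choose Suc m) = (2 * m + 1) * ((2 * m) choose m)"
        using Suc_times_binomial_eq[of "2 * m" m] by (simp add: mult.commute)
      moreover have "((2 * m + 1) choose Suc m) = ((2 * m + 1) choose m)"
        using binomial_symmetric[of m "2 * m + 1"] by simp
      ultimately show ?thesis by (simp only: mult.assoc)
    qed
    then have "real (Suc m) * real ((2 * Suc m) choose Suc m) = 2 * (2 * real m + 1) * real ((2 * m) choose m)"
      by (metis (no_types, lifting) of_nat_1 of_nat_add of_nat_mult of_nat_numeral)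
    then have "real ((2 * Suc m) choose Suc m) = 2 * (2 * real m + 1) * real ((2 * m) choose m) / (real m + 1)"
      by (simp add: field_simps del: binomial_Suc_Suc)
    moreover have "2 * P * C / n / (4 * p) = C / p * P / (2 * n)" for P C n p :: real
      by simp
    moreover have "2 * real m + 2 = 2 * (real m + 1)" by simp
    ultimately show ?thesis unfolding Q_def power_Suc by metis
  qed
  have "(\<Prod>k=1..m. (4*real k^2) / (4*real k^2 - 1)) = 1 / ((Q m)\<^sup>2 * (2 * real m + 1))" for m
  proof (induction m)
    case (Suc m)
    have "4 * (real (Suc m))\<^sup>2 - 1 = (2 * real m + 1) * (2 * real m + 3)"
      by (simp add: power2_eq_square algebra_simps)
    moreover have "4 * (real (Suc m))\<^sup>2 = (2 * real m + 2)\<^sup>2"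
      by (simp add: power2_eq_square algebra_simps)
    ultimately have "(\<Prod>k=1..Suc m. (4*real k^2) / (4*real k^2 - 1)) =
        1 / ((Q m)\<^sup>2 * (2 * real m + 1)) * ((2 * real m + 2)\<^sup>2 / ((2 * real m + 1) * (2 * real m + 3)))"
      using Suc by (simp del: of_nat_Suc)
    also have "\<dots> = 1 / ((Q (Suc m))\<^sup>2 * (2 * real (Suc m) + 1))"
      unfolding Q_Suc by (simp add: power_divide power_mult_distrib power2_eq_square add.commute mult_ac)
    finally show ?case .
  qed (simp add: Q_def)
  with wallis have "(\<lambda>m. 1 / ((Q m)\<^sup>2 * (2 * real m + 1))) \<longlonglongrightarrow> pi / 2" by simp
  from tendsto_inverse[OF this] show ?thesis by (simp add: Q_def)
qed

text \<open>For odd \<open>n\<close> the middle coefficient is half of the central one in the next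
  row, so \<open>n\<close> may be rounded up to an even number.\<close>

lemma survival_1: 
  "survival n 1 = real ((2 * ((n + 1) div 2)) choose ((n + 1) div 2)) / 4 ^ ((n + 1) div 2)"
proof (cases "even n")
  case True
  then obtain m where m: "n = 2 * m" by blast
  then show ?thesis by (simp add: survival_def power_mult)
next
  case False
  then obtain m where m: "n = 2 * m + 1" by (blast elim: oddE)
  have "(Suc (2 * m) choose m) = (Suc (2 * m) choose (Suc m))"
    using binomial_symmetric[of m "Suc (2 * m)"] by simp
  then show ?thesis by (simp add: survival_def m power_mult) (simp add: add_divide_distrib)
qed

lemma sqrt_ratio_tendsto_1: "(\<lambda>n. sqrt ((real n + 1) / (real n + 2))) \<longlonglongrightarrow> 1"
proof -
  have "(\<lambda>n. 1 - 1 / real (n + 2)) \<longlonglongrightarrow> 1 - 0"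
    by (intro tendsto_intros LIMSEQ_ignore_initial_segment lim_1_over_n)
  then have "(\<lambda>n. sqrt (1 - 1 / real (n + 2))) \<longlonglongrightarrow> sqrt (1 - 0)"
    by (rule tendsto_real_sqrt)
  moreover have "1 - 1 / real (n + 2) = (real n + 1) / (real n + 2)" for n
    by (simp add: field_simps)
  ultimately show ?thesis by simp
qed

lemma survival_1_tendsto: "(\<lambda>n. survival n 1 * sqrt (real n + 1)) \<longlonglongrightarrow> sqrt (2 / pi)"
proof -
  let ?h = "\<lambda>n::nat. (n + 1) div 2"
  \<comment> \<open>Corrects the normalisation: \<open>2 * ?h n + 1\<close> is \<open>n + 1\<close>
    or \<open>n + 2\<close>, depending on parity.\<close>
  let ?r = "\<lambda>n. sqrt ((real n + 1) / (2 * real (?h n) + 1))"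
  have h: "n \<le> 2 * ?h n" "2 * ?h n \<le> n + 1" for n by presburger+
  then have h': "real n \<le> 2 * real (?h n)" "2 * real (?h n) \<le> real n + 1" for n
    using of_nat_mono[OF h(1)[of n], where 'a = real] of_nat_mono[OF h(2)[of n], where 'a = real] by simp_all
  have "filterlim ?h at_top sequentially"
    unfolding filterlim_at_top
  proof
    fix Z :: nat
    show "eventually (\<lambda>n. Z \<le> ?h n) sequentially"
      using eventually_ge_at_top[of "2 * Z"] by eventually_elim simp
  qed
  from filterlim_compose[OF central_binomial_tendsto this]
  have "(\<lambda>n. (survival n 1)\<^sup>2 * (2 * real (?h n) + 1)) \<longlonglongrightarrow> 2 / pi"
    unfolding survival_1 .
  then have lim: "(\<lambda>n. sqrt ((survival n 1)\<^sup>2 * (2 * real (?h n) + 1))) \<longlonglongrightarrow> sqrt (2 / pi)"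
    by (rule tendsto_real_sqrt)
  have "?r \<longlonglongrightarrow> 1"
  proof (rule tendsto_sandwich[OF _ _ sqrt_ratio_tendsto_1 tendsto_const])
    show "eventually (\<lambda>n. sqrt ((real n + 1) / (real n + 2)) \<le> ?r n) sequentially"
      using h' by (intro always_eventually allI real_sqrt_le_mono divide_left_mono) (auto intro!: mult_pos_pos add_nonneg_pos)
    show "eventually (\<lambda>n. ?r n \<le> 1) sequentially"
      using h' by (intro always_eventually allI) (auto simp: divide_le_eq_1)
  qed
  from tendsto_mult[OF lim this]
  have "(\<lambda>n. sqrt ((survival n 1)\<^sup>2 * (2 * real (?h n) + 1)) * ?r n) \<longlonglongrightarrow> sqrt (2 / pi)" by simp
  moreover have "sqrt ((survival n 1)\<^sup>2 * (2 * real (?h n) + 1)) * ?r n = survival n 1 * sqrt (real n + 1)" for n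
  proof -
    have "0 < 2 * real (?h n) + 1" by linarith
    moreover have "0 \<le> survival n 1" by (simp add: survival_def sum_nonneg)
    ultimately show ?thesis by (simp add: real_sqrt_mult real_sqrt_divide)
  qed
  ultimately show ?thesis by simp
qed

text \<open>\<open>survival_Suc_left\<close>, solved for its largest distance, expresses distance
  \<open>d + 2\<close> by \<open>d + 1\<close> and \<open>d\<close>. In the limit this reads
  \<open>c (d + 2) = 2 * c (d + 1) - c d\<close>, so the constants are linear in
  \<open>d\<close>.\<close>

lemma survival_tendsto: "(\<lambda>n. survival n d * sqrt (real n + 1)) \<longlonglongrightarrow> real d * sqrt (2 / pi)"
proof (induction d rule: induct_nat_012)
  case 0
  show ?case by simp
next
  case 1
  show ?case using survival_1_tendsto by (simp only: One_nat_def of_nat_1 of_nat_Suc of_nat_0 add_0_right mult_1)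
next
  case (ge2 d)
  let ?c = "sqrt (2 / pi)"
  have "(\<lambda>n. 2 * (survival (Suc n) (Suc d) * sqrt (real (Suc n) + 1) * sqrt ((real n + 1) / (real n + 2)))
      - survival n d * sqrt (real n + 1)) \<longlonglongrightarrow> 2 * (real (Suc d) * ?c * 1) - real d * ?c"
    by (intro tendsto_intros sqrt_ratio_tendsto_1 ge2 LIMSEQ_Suc[OF ge2(2)])
  also have "(\<lambda>n. 2 * (survival (Suc n) (Suc d) * sqrt (real (Suc n) + 1) * sqrt ((real n + 1) / (real n + 2)))
      - survival n d * sqrt (real n + 1)) = (\<lambda>n. survival n (Suc (Suc d)) * sqrt (real n + 1))"
  proof
    fix n
    have "sqrt (real (Suc n) + 1) * sqrt ((real n + 1) / (real n + 2)) = sqrt (real n + 1)"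
      by (simp add: real_sqrt_divide add.commute)
    then have "2 * (survival (Suc n) (Suc d) * sqrt (real (Suc n) + 1) * sqrt ((real n + 1) / (real n + 2)))
       = (survival n d + survival n (d + 2)) * sqrt (real n + 1)"
      unfolding mult.assoc by (simp only: survival_Suc_left)
    then show "2 * (survival (Suc n) (Suc d) * sqrt (real (Suc n) + 1) * sqrt ((real n + 1) / (real n + 2)))
      - survival n d * sqrt (real n + 1) = survival n (Suc (Suc d)) * sqrt (real n + 1)"
      by (simp add: algebra_simps)
  qed
  also have "2 * (real (Suc d) * ?c * 1) - real d * ?c = real (Suc (Suc d)) * ?c"
    by (simp add: algebra_simps)
  finally show ?case .
qed

section \<open>Gambler's ruin between two barriers\<close>

text \<open>The ruin probability \<open>(x - z) / m\<close> is harmonic, so the error satisfies the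
  averaging recursion of the walk with value 0 at both ends. It is compared with a weight that
  shrinks by the factor \<open>1 - 1 / (2 * m\<^sup>2)\<close> per step.\<close>

lemma gambler_ruin_error:
  assumes "z < y" "z \<le> x" "x \<le> y"
  defines "m \<equiv> real_of_int (y - z)"
  shows "0 \<le> real_of_int (x - z) / m - hit_prob y z n x
    \<and> real_of_int (x - z) / m - hit_prob y z n x
       \<le> real_of_int ((x - z) * (y - x)) * (1 - 1 / (2 * m\<^sup>2)) ^ n"
  using assms(2,3)
proof (induction n arbitrary: x)
  case 0
  have m: "m > 0" using assms(1) by (simp add: m_def)
  show ?case
  proof (cases "x = y")
    case True
    then show ?thesis using m by (simp add: m_def)
  next
    case False
    \<comment> \<open>At time 0 the error is \<open>(x - z) / m\<close>; since positions are
      integers, \<open>y - x\<close> and \<open>y - z\<close> are at least 1, and the weight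
      dominates it.\<close>
    have "x - z \<le> (x - z) * (y - x) * (y - z)"
    proof -
      have "1 \<le> (y - x) * (y - z)" using False 0 assms(1)
        by (smt (verit) mult_le_cancel_left1)
      then have "(x - z) * 1 \<le> (x - z) * ((y - x) * (y - z))" using 0 by (intro mult_left_mono) auto
      then show ?thesis by (simp add: mult.assoc)
    qed
    then have "real_of_int (x - z) \<le> real_of_int ((x - z) * (y - x)) * m"
      unfolding m_def of_int_mult[symmetric] by (simp only: of_int_le_iff)
    then show ?thesis using False m 0 by (simp add: divide_le_eq)
  qed
next
  case (Suc n)
  have m1: "m \<ge> 1" using assms(1) by (simp add: m_def)
  let ?q = "1 - 1 / (2 * m\<^sup>2)"
  have q: "0 \<le> ?q" using mult_mono[OF m1 m1] m1 by (simp add: field_simps power2_eq_square)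
  consider "x = y" | "x = z" | "z < x" "x < y" using Suc.prems by linarith
  then show ?case
  proof cases
    case 1
    then show ?thesis using m1 by (simp add: m_def)
  next
    case 2
    then show ?thesis using assms(1) by simp
  next
    case 3
    let ?e = "\<lambda>x. real_of_int (x - z) / m - hit_prob y z n x"
    define i j where "i = real_of_int (x - z)" and "j = real_of_int (y - x)"
    have ij: "i \<ge> 1" "j \<ge> 1" "m = i + j" using 3 by (simp_all add: i_def j_def m_def)
    have e: "real_of_int (x - z) / m - hit_prob y z (Suc n) x = (?e (x - 1) + ?e (x + 1)) / 2"
      using 3 m1 by (simp add: field_simps)
    \<comment> \<open>The second difference of the weight is -2: averaging over the neighbours
      lowers it by exactly 1.\<close>
    have "(x - 1 - z) * (y - (x - 1)) + (x + 1 - z) * (y - (x + 1)) = 2 * ((x - z) * (y - x) - 1)"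
      by (simp add: algebra_simps)
    then have phi: "real_of_int ((x - 1 - z) * (y - (x - 1))) + real_of_int ((x + 1 - z) * (y - (x + 1))) = 2 * (i * j - 1)"
      unfolding i_def j_def by (metis of_int_1 of_int_add of_int_diff of_int_mult of_int_numeral)
    \<comment> \<open>Losing 1 is at least losing the fraction \<open>1 / (2 * m\<^sup>2)\<close>,
      because \<open>i * j \<le> 2 * m\<^sup>2\<close>. This crude bound fixes the rate.\<close>
    have "i * j - 1 \<le> i * j * ?q"
    proof -
      have "0 \<le> (i - j)\<^sup>2 + 2 * i * j" using ij by simp
      then have "i * j \<le> 2 * m\<^sup>2" using ij by (simp add: power2_eq_square algebra_simps)
      then have "i * j / (2 * m\<^sup>2) \<le> 1" using m1 by (simp add: divide_le_eq)
      then show ?thesis by (simp add: algebra_simps)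
    qed
    then have "(i * j - 1) * ?q ^ n \<le> (i * j * ?q) * ?q ^ n"
      using q by (intro mult_right_mono zero_le_power)
    then have step: "(i * j - 1) * ?q ^ n \<le> i * j * ?q ^ Suc n" by (simp only: power_Suc mult.assoc)
    have "?e (x - 1) + ?e (x + 1) \<le> (2 * (i * j - 1)) * ?q ^ n"
      using Suc.IH[of "x - 1"] Suc.IH[of "x + 1"] 3 unfolding phi[symmetric]
      by (simp add: distrib_right)
    then have "(?e (x - 1) + ?e (x + 1)) / 2 \<le> (i * j - 1) * ?q ^ n"
      unfolding mult.assoc by (simp only: pos_divide_le_eq zero_less_numeral mult.commute)
    also note step
    finally have "(?e (x - 1) + ?e (x + 1)) / 2 \<le> real_of_int ((x - z) * (y - x)) * ?q ^ Suc n"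
      by (simp only: i_def j_def of_int_mult)
    moreover have "0 \<le> (?e (x - 1) + ?e (x + 1)) / 2"
      using Suc.IH[of "x - 1"] Suc.IH[of "x + 1"] 3 by (simp add: add_nonneg_nonneg)
    ultimately show ?thesis unfolding e by blast
  qed
qed

section \<open>The hitting probability as a Poisson average\<close>

text \<open>First-step decomposition. The shifted walk no longer counts its own starting point, so
  arrival at \<open>y\<close> by the first step is a separate alternative.\<close>

lemma walk_hits_Suc:
  "walk_hits y z x f (Suc k) \<longleftrightarrow>
     (x + f 0 = y \<and> y \<noteq> z) \<or> (x + f 0 \<noteq> z \<and> walk_hits y z (x + f 0) (\<lambda>j. f (Suc j)) k)"
proof -
  have W: "x + (\<Sum>i<Suc n. f i) = x + f 0 + (\<Sum>i<n. f (Suc i))" for n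
    unfolding sum.lessThan_Suc_shift by simp
  have all: "(\<forall>j\<in>{1..Suc n}. P j) \<longleftrightarrow> P 1 \<and> (\<forall>j\<in>{1..n}. P (Suc j))" for n and P :: "nat \<Rightarrow> bool"
  proof -
    have eq: "{1..Suc n} = insert 1 (Suc ` {1..n})" by (auto simp: image_iff)
    show ?thesis unfolding eq by blast
  qed
  have ex: "(\<exists>j\<in>{1..Suc n}. P j) \<longleftrightarrow> P 1 \<or> (\<exists>j\<in>{1..n}. P (Suc j))" for n and P :: "nat \<Rightarrow> bool"
    using all[of n "\<lambda>j. \<not> P j"] by blast
  show ?thesis
    unfolding walk_hits_def ex all W by auto
qed

section \<open>Jump counts and steps on the probability space\<close>

locale exponential_walk = prob_space M for M :: "'a measure" +
  fixes a :: real and E :: "nat \<Rightarrow> 'a \<Rightarrow> real" and xi :: "nat \<Rightarrow> 'a \<Rightarrow> int"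
  assumes a_pos: "0 < a"
    and E_distr: "\<And>k. distributed M lborel (E k) (\<lambda>s. ennreal (exponential_density a s))"
    and xi_meas [measurable]: "\<And>k. xi k \<in> measurable M (count_space UNIV)"
    and xi_1: "\<And>k. measure M {\<omega> \<in> space M. xi k \<omega> = 1} = 1/2"
    and xi_m1: "\<And>k. measure M {\<omega> \<in> space M. xi k \<omega> = -1} = 1/2"
    and indep: "indep_vars (\<lambda>_. borel)
           (\<lambda>i. case i of Inl k \<Rightarrow> E k | Inr k \<Rightarrow> (\<lambda>\<omega>. real_of_int (xi k \<omega>)))
           (UNIV :: (nat + nat) set)"
begin

definition T :: "nat \<Rightarrow> 'a \<Rightarrow> real" where
  "T n \<omega> = (\<Sum>j<n. E j \<omega>)"

lemma E_meas [measurable]: "E k \<in> borel_measurable M"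
  using distributed_measurable[OF E_distr[of k]] by simp

lemma T_meas [measurable]: "T n \<in> borel_measurable M"
  unfolding T_def[abs_def] by measurable

text \<open>A sum of \<open>n\<close> exponential times is Erlang distributed, and its distribution
  function is a Poisson tail. The case 0 is separate because \<open>erlang_density m\<close> belongs
  to \<open>m + 1\<close> summands.\<close>

lemma prob_T_le:
  assumes "0 \<le> t"
  shows "prob {\<omega> \<in> space M. T n \<omega> \<le> t} = 1 - (\<Sum>k<n. pois (a * t) k)"
proof (cases n)
  case 0
  then show ?thesis using assms by (simp add: T_def prob_space)
next
  case (Suc m)
  let ?I = "Inl ` {..<Suc m} :: (nat + nat) set"
  let ?X = "\<lambda>i. case i of Inl k \<Rightarrow> E k | Inr k \<Rightarrow> (\<lambda>\<omega>. real_of_int (xi k \<omega>))"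
  have "distributed M lborel (\<lambda>\<omega>. \<Sum>i\<in>?I. ?X i \<omega>) (erlang_density (card ?I - 1) a)"
    using a_pos E_distr by (intro exponential_distributed_sum indep_vars_subset[OF indep]) auto
  moreover have "(\<lambda>\<omega>. \<Sum>i\<in>?I. ?X i \<omega>) = T n"
    by (subst sum.reindex) (auto simp: T_def fun_eq_iff Suc)
  moreover have "card ?I = Suc m" by (simp add: card_image)
  ultimately have "distributed M lborel (T n) (erlang_density m a)" by simp
  from erlang_distributed_le[OF this a_pos assms]
  show ?thesis using assms by (simp add: erlang_CDF_def Suc pois_def lessThan_Suc_atMost)
qed

lemma AE_E_pos: "AE \<omega> in M. \<forall>k. 0 < E k \<omega>"
proof (subst AE_all_countable, rule allI)
  fix k
  have "prob {\<omega> \<in> space M. E k \<omega> \<le> 0} = 0"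
    using erlang_distributed_le[OF E_distr a_pos, of 0 k] by (simp add: erlang_CDF_def)
  then have "AE \<omega> in M. \<not> E k \<omega> \<le> 0" by (subst (asm) prob_Collect_eq_0) auto
  then show "AE \<omega> in M. 0 < E k \<omega>" by eventually_elim simp
qed

lemma AE_xi: "AE \<omega> in M. \<forall>k. xi k \<omega> = 1 \<or> xi k \<omega> = -1"
proof (subst AE_all_countable, rule allI)
  fix k
  have "prob ({\<omega> \<in> space M. xi k \<omega> = 1} \<union> {\<omega> \<in> space M. xi k \<omega> = -1}) =
      prob {\<omega> \<in> space M. xi k \<omega> = 1} + prob {\<omega> \<in> space M. xi k \<omega> = -1}"
    by (rule finite_measure_Union) auto
  then have "prob ({\<omega> \<in> space M. xi k \<omega> = 1} \<union> {\<omega> \<in> space M. xi k \<omega> = -1}) = 1"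
    by (simp add: xi_1 xi_m1)
  then have "AE \<omega> in M. \<omega> \<in> {\<omega> \<in> space M. xi k \<omega> = 1} \<union> {\<omega> \<in> space M. xi k \<omega> = -1}"
    by (rule AE_prob_1)
  then show "AE \<omega> in M. xi k \<omega> = 1 \<or> xi k \<omega> = -1" by eventually_elim auto
qed

text \<open>Staying below \<open>m\<close> forever is contained in every event
  \<open>T n \<omega> \<le> m\<close>, whose probabilities are Poisson tails tending to 0.\<close>

lemma AE_T_unbounded: "AE \<omega> in M. \<forall>m::nat. \<exists>n. real m < T n \<omega>"
proof (subst AE_all_countable, rule allI)
  fix m :: nat
  let ?p = "prob {\<omega> \<in> space M. \<forall>n. T n \<omega> \<le> real m}"
  have "?p \<le> 1 - (\<Sum>k<n. pois (a * real m) k)" for n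
    unfolding prob_T_le[symmetric, OF of_nat_0_le_iff]
    by (rule finite_measure_mono) auto
  moreover have "(\<lambda>n. 1 - (\<Sum>k<n. pois (a * real m) k)) \<longlonglongrightarrow> 1 - 1"
    using sums_pois[of "a * real m"] unfolding sums_def by (intro tendsto_intros)
  ultimately have "?p \<le> 0"
    by (intro LIMSEQ_le_const[of _ 0]) auto
  then have "?p = 0" by (simp add: measure_le_0_iff)
  then have "AE \<omega> in M. \<not> (\<forall>n. T n \<omega> \<le> real m)" by (subst (asm) prob_Collect_eq_0) auto
  then show "AE \<omega> in M. \<exists>n. real m < T n \<omega>" by eventually_elim (simp add: not_le)
qed

definition jumps_eq :: "nat \<Rightarrow> real \<Rightarrow> 'a set" where
  "jumps_eq k t = {\<omega> \<in> space M. T k \<omega> \<le> t \<and> t < T (Suc k) \<omega>}"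

lemma jumps_eq_sets [measurable]: "jumps_eq k t \<in> sets M"
  unfolding jumps_eq_def by measurable

lemma prob_jumps_eq:
  assumes "0 \<le> t"
  shows "prob (jumps_eq k t) = pois (a * t) k"
proof -
  have "prob (jumps_eq k t) = prob ({\<omega> \<in> space M. T k \<omega> \<le> t} - {\<omega> \<in> space M. T k \<omega> \<le> t \<and> T (Suc k) \<omega> \<le> t})"
    by (rule arg_cong[where f = prob]) (auto simp: jumps_eq_def)
  also have "\<dots> = prob {\<omega> \<in> space M. T k \<omega> \<le> t} - prob {\<omega> \<in> space M. T k \<omega> \<le> t \<and> T (Suc k) \<omega> \<le> t}"
    by (rule finite_measure_Diff) auto
  also have "prob {\<omega> \<in> space M. T k \<omega> \<le> t \<and> T (Suc k) \<omega> \<le> t} = prob {\<omega> \<in> space M. T (Suc k) \<omega> \<le> t}"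
  proof (rule prob_eq_AE)
    show "AE \<omega> in M. (T k \<omega> \<le> t \<and> T (Suc k) \<omega> \<le> t) = (T (Suc k) \<omega> \<le> t)"
      using AE_E_pos
    proof eventually_elim
      case (elim \<omega>)
      then have "T k \<omega> < T (Suc k) \<omega>" by (simp add: T_def)
      then show ?case by auto
    qed
  qed auto
  finally show ?thesis by (simp add: prob_T_le[OF assms])
qed

text \<open>A cylinder set. The pattern is a total function, so prolonging the cylinder by one
  prescribed step is a function update.\<close>

definition steps_eq :: "nat \<Rightarrow> (nat \<Rightarrow> int) \<Rightarrow> 'a set" where
  "steps_eq s e = {\<omega> \<in> space M. \<forall>j<s. xi j \<omega> = e j}"

lemma steps_eq_sets [measurable]: "steps_eq s e \<in> sets M"
  unfolding steps_eq_def by measurable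

lemma prob_steps_eq:
  assumes "\<And>j. e j = 1 \<or> e j = -1"
  shows "prob (steps_eq s e) = 1 / 2 ^ s"
proof (cases "s = 0")
  case True
  then show ?thesis by (simp add: steps_eq_def prob_space)
next
  case False
  let ?J = "Inr ` {..<s} :: (nat + nat) set"
  let ?X = "\<lambda>i. case i of Inl k \<Rightarrow> E k | Inr k \<Rightarrow> (\<lambda>\<omega>. real_of_int (xi k \<omega>))"
  let ?A = "\<lambda>i. case i of Inl k \<Rightarrow> UNIV | Inr k \<Rightarrow> {real_of_int (e k)}"
  have "steps_eq s e = (\<Inter>i\<in>?J. ?X i -` ?A i \<inter> space M)"
    using False by (auto simp: steps_eq_def)
  also have "prob \<dots> = (\<Prod>i\<in>?J. prob (?X i -` ?A i \<inter> space M))"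
    using False by (intro indep_varsD[OF indep]) auto
  also have "\<dots> = (\<Prod>j<s. prob {\<omega> \<in> space M. xi j \<omega> = e j})"
    by (subst prod.reindex) (auto intro!: prod.cong arg_cong[where f = prob])
  also have "\<dots> = (\<Prod>j<s. 1 / 2)"
  proof (rule prod.cong[OF refl])
    fix j
    show "prob {\<omega> \<in> space M. xi j \<omega> = e j} = 1 / 2"
      using assms[of j] xi_1[of j] xi_m1[of j] by auto
  qed
  finally show ?thesis by (simp add: power_one_over)
qed

text \<open>The holding times and the steps are disjoint blocks of one independent family, hence
  independent as blocks; the jump count depends on the first block only.\<close>

lemma prob_jumps_steps:
  assumes "\<And>j. e j = 1 \<or> e j = -1"
  shows "prob (jumps_eq k t \<inter> steps_eq s e) = prob (jumps_eq k t) / 2 ^ s"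
proof -
  let ?X = "\<lambda>i. case i of Inl k \<Rightarrow> E k | Inr k \<Rightarrow> (\<lambda>\<omega>. real_of_int (xi k \<omega>))"
  let ?A = "range Inl :: (nat + nat) set" and ?B = "range Inr :: (nat + nat) set"
  let ?PA = "Pi\<^sub>M ?A (\<lambda>_. borel :: real measure)" and ?PB = "Pi\<^sub>M ?B (\<lambda>_. borel :: real measure)"
  let ?XA = "\<lambda>\<omega>. \<lambda>i\<in>?A. ?X i \<omega>" and ?XB = "\<lambda>\<omega>. \<lambda>i\<in>?B. ?X i \<omega>"
  let ?SA = "{f \<in> space ?PA. (\<Sum>j<k. f (Inl j)) \<le> t \<and> t < (\<Sum>j<Suc k. f (Inl j))}"
  let ?SB = "{f \<in> space ?PB. \<forall>j<s. f (Inr j) = real_of_int (e j)}"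
  have [measurable]: "(\<lambda>f. f (Inl j)) \<in> borel_measurable ?PA" "(\<lambda>f. f (Inr j)) \<in> borel_measurable ?PB" for j
    by (intro measurable_component_singleton; simp)+
  have ind: "indep_var ?PA ?XA ?PB ?XB"
    by (rule indep_var_restrict[OF indep]) auto
  have sets: "?SA \<in> sets ?PA" "?SB \<in> sets ?PB" by measurable
  have A: "?XA -` ?SA \<inter> space M = jumps_eq k t"
    by (auto simp: jumps_eq_def T_def space_PiM)
  have B: "?XB -` ?SB \<inter> space M = steps_eq s e"
    by (auto simp: steps_eq_def space_PiM)
  have "(\<lambda>\<omega>. (?XA \<omega>, ?XB \<omega>)) -` (?SA \<times> ?SB) \<inter> space M = jumps_eq k t \<inter> steps_eq s e"
    unfolding A[symmetric] B[symmetric] by auto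
  with indep_varD[OF ind sets] show ?thesis
    unfolding A B prob_steps_eq[OF assms] by simp
qed

lemma walk_hits_sets [measurable]:
  "{\<omega> \<in> space M. walk_hits y z x (\<lambda>j. xi (s + j) \<omega>) k} \<in> sets M"
proof -
  have [measurable]: "(\<lambda>\<omega>. x + (\<Sum>i<n. xi (s + i) \<omega>)) \<in> measurable M (count_space UNIV)" for n
    by (rule measurable_walk) simp
  show ?thesis unfolding walk_hits_def by measurable
qed

text \<open>Takes the place of the Markov property. With the first \<open>s\<close> steps
  prescribed, the next step splits the cylinder into two of length \<open>s + 1\<close>, so the
  induction on \<open>k\<close> must leave \<open>s\<close>, \<open>e\<close> and \<open>x\<close>
  free. \<open>B\<close> is any event independent of all cylinders.\<close>

lemma prob_walk_hits_given_steps: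
  assumes B [measurable]: "B \<in> sets M"
    and B_indep: "\<And>s e. (\<And>j. e j = 1 \<or> e j = -1) \<Longrightarrow> prob (B \<inter> steps_eq s e) = prob B / 2 ^ s"
    and "y \<noteq> z"
    and e: "\<And>j. e j = 1 \<or> e j = -1"
  shows "prob (B \<inter> steps_eq s e \<inter> {\<omega> \<in> space M. walk_hits y z x (\<lambda>j. xi (s + j) \<omega>) k})
     = return_prob y z k x * (prob B / 2 ^ s)"
  using e
proof (induction k arbitrary: x s e)
  case 0
  then show ?case by (simp add: walk_hits_def)
next
  case (Suc k)
  let ?C = "\<lambda>\<sigma>. B \<inter> steps_eq (Suc s) (e(s := \<sigma>)) \<inter>
     {\<omega> \<in> space M. x + \<sigma> = y \<or> (x + \<sigma> \<noteq> z \<and> walk_hits y z (x + \<sigma>) (\<lambda>j. xi (Suc s + j) \<omega>) k)}"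
  have C_meas: "?C \<sigma> \<in> sets M" for \<sigma>
    by (intro sets.Int B steps_eq_sets) (use walk_hits_sets[of y z "x + \<sigma>" "Suc s" k] in measurable)
  \<comment> \<open>After the step \<open>\<sigma>\<close> the new position itself counts as a
    visit, hence \<open>hit_prob\<close> instead of \<open>return_prob\<close>.\<close>
  have C: "prob (?C \<sigma>) = hit_prob y z k (x + \<sigma>) * (prob B / 2 ^ Suc s)" if "\<sigma> = 1 \<or> \<sigma> = -1" for \<sigma>
  proof -
    have e': "(e(s := \<sigma>)) j = 1 \<or> (e(s := \<sigma>)) j = -1" for j using Suc.prems[of j] that by simp
    consider "x + \<sigma> = y" | "x + \<sigma> \<noteq> y" "x + \<sigma> = z" | "x + \<sigma> \<noteq> y" "x + \<sigma> \<noteq> z" by blast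
    then show ?thesis
    proof cases
      case 1
      then have "?C \<sigma> = B \<inter> steps_eq (Suc s) (e(s := \<sigma>))" using sets.sets_into_space[OF B] by auto
      then show ?thesis using 1 B_indep[of "e(s := \<sigma>)" "Suc s", OF e'] by (simp add: hit_prob_return_prob)
    next
      case 2
      then have "hit_prob y z k (x + \<sigma>) = 0" by (auto simp: hit_prob_return_prob)
      then show ?thesis using 2 by simp
    next
      case 3
      then show ?thesis using Suc.IH[of "e(s := \<sigma>)" "Suc s" "x + \<sigma>", OF e']
        by (simp add: hit_prob_return_prob fun_upd_def)
    qed
  qed
  have "prob (B \<inter> steps_eq s e \<inter> {\<omega> \<in> space M. walk_hits y z x (\<lambda>j. xi (s + j) \<omega>) (Suc k)})
     = prob (?C 1 \<union> ?C (-1))"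
  proof (rule finite_measure_eq_AE)
    show "AE \<omega> in M. \<omega> \<in> B \<inter> steps_eq s e \<inter> {\<omega> \<in> space M. walk_hits y z x (\<lambda>j. xi (s + j) \<omega>) (Suc k)}
      \<longleftrightarrow> \<omega> \<in> ?C 1 \<union> ?C (-1)"
      using AE_xi
    proof eventually_elim
      case (elim \<omega>)
      have *: "\<omega> \<in> steps_eq (Suc s) (e(s := \<sigma>)) \<longleftrightarrow> \<omega> \<in> steps_eq s e \<and> xi s \<omega> = \<sigma>" for \<sigma>
        unfolding steps_eq_def by (auto simp: less_Suc_eq)
      have "xi s \<omega> = 1 \<or> xi s \<omega> = -1" using elim by blast
      then show ?case
        using \<open>y \<noteq> z\<close> unfolding walk_hits_Suc Int_iff Un_iff * mem_Collect_eq by auto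
    qed
    show "B \<inter> steps_eq s e \<inter> {\<omega> \<in> space M. walk_hits y z x (\<lambda>j. xi (s + j) \<omega>) (Suc k)} \<in> sets M"
      by (intro sets.Int B steps_eq_sets walk_hits_sets)
    show "?C 1 \<union> ?C (-1) \<in> sets M" by (intro sets.Un C_meas)
  qed
  also have "\<dots> = prob (?C 1) + prob (?C (-1))"
  proof (rule finite_measure_Union[OF C_meas C_meas])
    have "\<omega> \<notin> steps_eq (Suc s) (e(s := -1))" if "\<omega> \<in> steps_eq (Suc s) (e(s := 1))" for \<omega>
      using that unfolding steps_eq_def by (auto dest!: spec[of _ s])
    then show "?C 1 \<inter> ?C (-1) = {}" by blast
  qed
  also have "\<dots> = hit_prob y z k (x + 1) * (prob B / 2 ^ Suc s) + hit_prob y z k (x + - 1) * (prob B / 2 ^ Suc s)"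
    by (rule arg_cong2[where f = "(+)"]; rule C; simp)
  also have "\<dots> = return_prob y z (Suc k) x * (prob B / 2 ^ s)"
    by (simp add: field_simps)
  finally show ?case .
qed

lemma prob_jumps_walk_hits:
  assumes "0 \<le> t" "y \<noteq> z"
  shows "prob (jumps_eq k t \<inter> {\<omega> \<in> space M. walk_hits y z x (\<lambda>j. xi j \<omega>) k})
     = pois (a * t) k * return_prob y z k x"
proof -
  have "steps_eq 0 (\<lambda>_. 1) = space M" by (simp add: steps_eq_def)
  then show ?thesis
    using prob_walk_hits_given_steps[of "jumps_eq k t" y z "\<lambda>_. 1" 0 x k] prob_jumps_steps assms
      sets.sets_into_space[OF jumps_eq_sets, of k t]
    by (simp add: prob_jumps_eq Int_absorb2 mult.commute)
qed

text \<open>The hitting event is decomposed according to the number of jumps up to \<open>t\<close>;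
  the pieces are joined by countable additivity.\<close>

lemma H_fun_sums:
  assumes t: "0 \<le> t" and "y \<noteq> z"
  shows "(\<lambda>k. pois (a * t) k * return_prob y z k x) sums H_fun M (srw_pos x E xi) y z t"
proof -
  let ?hits = "\<lambda>k. {\<omega> \<in> space M. walk_hits y z x (\<lambda>j. xi j \<omega>) k}"
  let ?pos = "{\<omega> \<in> space M. \<forall>k. 0 < E k \<omega>}"
  \<comment> \<open>Intersecting with \<open>?pos\<close> makes the pieces truly disjoint: only with
    positive holding times does the path determine the index \<open>k\<close>.\<close>
  let ?C = "\<lambda>k. jumps_eq k t \<inter> ?hits k \<inter> ?pos"
  have hits [measurable]: "?hits k \<in> sets M" for k
    using walk_hits_sets[of y z x 0 k] by simp
  have C_meas: "?C k \<in> sets M" for k by measurable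
  have mono: "strict_mono (\<lambda>n. T n \<omega>)" if "\<forall>k. 0 < E k \<omega>" for \<omega>
    using that by (intro strict_monoI_Suc) (simp add: T_def)
  have disj: "disjoint_family ?C"
    unfolding disjoint_family_on_def
  proof safe
    fix k l :: nat and \<omega>
    assume *: "k \<noteq> l" "\<omega> \<in> jumps_eq k t" "\<omega> \<in> jumps_eq l t" "\<forall>k. 0 < E k \<omega>"
    have "card {n. 1 \<le> n \<and> T n \<omega> \<le> t} = k" "card {n. 1 \<le> n \<and> T n \<omega> \<le> t} = l"
      using * card_jumps_eq[OF mono[OF *(4)]] unfolding jumps_eq_def by blast+
    with * show "\<omega> \<in> {}" by simp
  qed
  have "prob (?C k) = pois (a * t) k * return_prob y z k x" for k
  proof -
    have "prob (?C k) = prob (jumps_eq k t \<inter> ?hits k)"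
    proof (rule finite_measure_eq_AE)
      show "AE \<omega> in M. \<omega> \<in> ?C k \<longleftrightarrow> \<omega> \<in> jumps_eq k t \<inter> ?hits k"
        using AE_E_pos AE_space by eventually_elim auto
    qed measurable
    then show ?thesis using prob_jumps_walk_hits[OF assms] by simp
  qed
  moreover have "(\<lambda>k. prob (?C k)) sums prob (\<Union>k. ?C k)"
    using C_meas disj by (intro finite_measure_UNION) auto
  moreover have "prob (\<Union>k. ?C k) = H_fun M (srw_pos x E xi) y z t"
    unfolding H_fun_def
  proof (rule finite_measure_eq_AE)
    show "AE \<omega> in M. \<omega> \<in> (\<Union>k. ?C k) \<longleftrightarrow>
       \<omega> \<in> {\<omega> \<in> space M. hit_time (srw_pos x E xi) y z \<omega> \<le> ereal t}"
      using AE_E_pos AE_xi AE_T_unbounded AE_space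
    proof eventually_elim
      case (elim \<omega>)
      note m = mono[OF elim(1)]
      have unb: "\<exists>n. s < T n \<omega>" for s
      proof -
        obtain m :: nat where "s < real m" using reals_Archimedean2 by blast
        with elim(3) show ?thesis by (meson less_trans)
      qed
      obtain n where "t < T n \<omega>" using unb by blast
      then obtain k where k: "T k \<omega> \<le> t" "t < T (Suc k) \<omega>"
        using jump_index_exists[of "\<lambda>n. T n \<omega>" t n] t by (auto simp: T_def)
      have xi0: "xi j \<omega> \<noteq> 0" for j using elim(2)[rule_format, of j] by auto
      have iff: "hit_time (srw_pos x E xi) y z \<omega> \<le> ereal t \<longleftrightarrow> walk_hits y z x (\<lambda>j. xi j \<omega>) k"
        using m unb xi0 k unfolding T_def by (rule hit_time_le_iff_walk_hits)
      have "\<omega> \<in> jumps_eq l t \<longleftrightarrow> l = k" for l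
        using card_jumps_eq[OF m, of l t] card_jumps_eq[OF m k] k elim(4)
        unfolding jumps_eq_def by auto
      then show ?case using iff elim by auto
    qed
    show "(\<Union>k. ?C k) \<in> sets M" using C_meas by blast
    show "{\<omega> \<in> space M. hit_time (srw_pos x E xi) y z \<omega> \<le> ereal t} \<in> sets M"
      using measurable_srw_hit_time[of E M xi x y z] by measurable
  qed
  ultimately show ?thesis by simp
qed

end

section \<open>Asymptotics\<close>

lemma pois_mixture_complement:
  assumes "(\<lambda>k. pois \<mu> k * r k) sums h"
  shows "(\<Sum>k. pois \<mu> k * (p - r k)) = p - h"
proof -
  have "(\<lambda>k. pois \<mu> k * p - pois \<mu> k * r k) sums (1 * p - h)"
    by (intro sums_diff sums_mult2 sums_pois assms)
  then show ?thesis by (simp add: sums_iff right_diff_distrib)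
qed

lemma pois_mixture_asymp_equiv:
  assumes a: "0 < a"
    and H: "\<And>t. 0 \<le> t \<Longrightarrow> (\<lambda>k. pois (a * t) k * r k) sums H t"
    and lim: "(\<lambda>k. (p - r k) * sqrt (real k + 1)) \<longlonglongrightarrow> c" and "c \<noteq> 0"
  shows "(\<lambda>t. p - H t) \<sim>[at_top] (\<lambda>t. c / (sqrt a * sqrt t))"
proof (rule asymp_equivI')
  have "filterlim (\<lambda>t. a * t) at_top at_top"
    using a by (intro filterlim_tendsto_pos_mult_at_top[OF tendsto_const] filterlim_ident)
  from filterlim_compose[OF pois_average_asymptotics[OF lim] this]
  have "((\<lambda>t. sqrt (a * t) * (\<Sum>k. pois (a * t) k * (p - r k)) / c) \<longlongrightarrow> c / c) at_top"
    using \<open>c \<noteq> 0\<close> by (intro tendsto_divide tendsto_const)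
  moreover have "eventually (\<lambda>t. sqrt (a * t) * (\<Sum>k. pois (a * t) k * (p - r k)) / c
      = (p - H t) / (c / (sqrt a * sqrt t))) at_top"
    using eventually_gt_at_top[of 0]
  proof eventually_elim
    case (elim t)
    then show ?case using pois_mixture_complement[OF H[of t], of p] by (simp add: real_sqrt_mult)
  qed
  ultimately show "((\<lambda>t. (p - H t) / (c / (sqrt a * sqrt t))) \<longlongrightarrow> 1) at_top"
    using \<open>c \<noteq> 0\<close> by (simp add: tendsto_cong)
qed

text \<open>The average of the bound is \<open>C * exp (- a * t * (1 - q))\<close>. The strict gap
  between \<open>\<epsilon>\<close> and \<open>1 - q\<close> leaves a decaying factor, which
  upgrades the bound to little-o.\<close>

lemma pois_mixture_exponential:
  assumes a: "0 < a"
    and H: "\<And>t. 0 \<le> t \<Longrightarrow> (\<lambda>k. pois (a * t) k * r k) sums H t"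
    and bound: "\<And>k. \<bar>p - r k\<bar> \<le> C * q ^ k" and "\<epsilon> < 1 - q"
  shows "(\<lambda>t. p - H t) \<in> o[at_top](\<lambda>t. exp (- a * \<epsilon> * t))"
proof (rule smalloI_tendsto)
  define b where "b = a * (1 - q - \<epsilon>)"
  have b: "b > 0" using assms by (simp add: b_def)
  have "filterlim (\<lambda>t. b * t) at_top at_top"
    using b by (intro filterlim_tendsto_pos_mult_at_top[OF tendsto_const] filterlim_ident)
  then have "((\<lambda>t. exp (- (b * t))) \<longlongrightarrow> 0) at_top"
    by (intro filterlim_compose[OF exp_at_bot] filterlim_uminus_at_top[THEN iffD1])
  from tendsto_mult_right_zero[OF this] have "((\<lambda>t. C * exp (- (b * t))) \<longlongrightarrow> 0) at_top" .
  then show "((\<lambda>t. (p - H t) / exp (- a * \<epsilon> * t)) \<longlongrightarrow> 0) at_top"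
  proof (rule Lim_null_comparison[rotated])
    show "eventually (\<lambda>t. norm ((p - H t) / exp (- a * \<epsilon> * t)) \<le> C * exp (- (b * t))) at_top"
      using eventually_ge_at_top[of 0]
    proof eventually_elim
      case (elim t)
      have "\<bar>p - H t\<bar> \<le> C * exp (- (a * t * (1 - q)))"
        using pois_average_geometric[of "a * t" "\<lambda>k. p - r k", OF _ bound] elim a
        by (simp add: pois_mixture_complement[OF H[OF elim]])
      also have "exp (- (a * t * (1 - q))) = exp (- (b * t)) * exp (- a * \<epsilon> * t)"
        by (simp add: exp_add[symmetric] b_def algebra_simps)
      finally show ?case by (simp add: divide_le_eq mult.assoc)
    qed
  qed
qed simp

section \<open>Discrete tails for each starting point\<close>

lemma return_prob_eq_hit_prob: "x \<noteq> y \<Longrightarrow> x \<noteq> z \<Longrightarrow> return_prob y z n x = hit_prob y z n x"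
  by (simp add: hit_prob_return_prob)

lemma hit_prob_survival_above:
  assumes "z < y" "y \<le> x"
  shows "hit_prob y z n x = 1 - survival n (nat (x - y))"
  using hit_prob_survival[of "- y" "- z" "- x" n] assms by (simp add: hit_prob_reflect)

lemma return_prob_tail_above:
  assumes "z < y" "y < x"
  shows "(\<lambda>k. (1 - return_prob y z k x) * sqrt (real k + 1)) \<longlonglongrightarrow> real_of_int (x - y) * sqrt (2 / pi)"
  using survival_tendsto[of "nat (x - y)"] assms
  by (simp add: return_prob_eq_hit_prob hit_prob_survival_above)

lemma ruin_rate_bounds:
  fixes m :: real
  assumes "1 \<le> m"
  shows "1 / 2 \<le> 1 - 1 / (2 * m\<^sup>2)" "1 - 1 / (2 * m\<^sup>2) < 1"
proof -
  have "1 \<le> m\<^sup>2" using assms by simp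
  then have "1 / m\<^sup>2 \<le> 1" "0 < 1 / m\<^sup>2" using assms by (simp_all add: divide_le_eq)
  then show "1 / 2 \<le> 1 - 1 / (2 * m\<^sup>2)" "1 - 1 / (2 * m\<^sup>2) < 1" by simp_all
qed

text \<open>The first step leads to \<open>y + 1\<close>, with survival tail at distance 1, or to
  \<open>y - 1\<close>, where the error is geometric. The limit is the mean of 1 and
  \<open>1 - 1 / m\<close>, and only half of the survival tail remains.\<close>

lemma return_prob_tail_from_target:
  assumes "z < y"
  shows "(\<lambda>k. (1 - 1 / (2 * real_of_int (y - z)) - return_prob y z k y) * sqrt (real k + 1))
    \<longlonglongrightarrow> sqrt (2 / pi) / 2"
proof (rule LIMSEQ_imp_Suc)
  define m where "m = real_of_int (y - z)"
  define q where "q = 1 - 1 / (2 * m\<^sup>2)"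
  have m1: "1 \<le> m" using assms by (simp add: m_def)
  then have q: "0 \<le> q" "q < 1" unfolding q_def using ruin_rate_bounds[of m] by linarith+
  define e where "e k = 1 - 1 / m - hit_prob y z k (y - 1)" for k
  have ratio: "real_of_int (y - 1 - z) / m = 1 - 1 / m" using m1 by (simp add: m_def field_simps)
  have "real_of_int ((y - 1 - z) * (y - (y - 1))) = m - 1" by (simp add: m_def)
  note ruin = gambler_ruin_error[of z y "y - 1", folded m_def, unfolded this ratio, folded e_def q_def]
  have e: "0 \<le> e k" "e k \<le> (m - 1) * q ^ k" for k
    using ruin[of k] assms by simp_all
  have lim: "(\<lambda>k. (m - 1) * (real k * q ^ k + 2 * q ^ k)) \<longlonglongrightarrow> (m - 1) * (0 + 2 * 0)"
    using q by (intro tendsto_intros LIMSEQ_power_zero powser_times_n_limit_0) auto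
  have "(\<lambda>k. e k * sqrt (real k + 2)) \<longlonglongrightarrow> 0"
  proof (rule Lim_null_comparison)
    show "eventually (\<lambda>k. norm (e k * sqrt (real k + 2)) \<le> (m - 1) * (real k * q ^ k + 2 * q ^ k)) sequentially"
    proof (intro always_eventually allI)
      fix k
      have "sqrt (real k + 2) \<le> real k + 2" by (rule real_le_lsqrt) (auto simp: power2_eq_square algebra_simps)
      then have "e k * sqrt (real k + 2) \<le> ((m - 1) * q ^ k) * (real k + 2)"
        using e[of k] by (intro mult_mono) auto
      then show "norm (e k * sqrt (real k + 2)) \<le> (m - 1) * (real k * q ^ k + 2 * q ^ k)"
        using e(1)[of k] by (simp add: abs_mult algebra_simps)
    qed
    show "(\<lambda>k. (m - 1) * (real k * q ^ k + 2 * q ^ k)) \<longlonglongrightarrow> 0" using lim by simp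
  qed
  \<comment> \<open>One step is already spent: the quotient turns \<open>sqrt (k + 1)\<close> into
    \<open>sqrt (k + 2)\<close>, the normalisation at \<open>Suc k\<close>.\<close>
  moreover have "(\<lambda>k. survival k 1 * sqrt (real k + 1) / sqrt ((real k + 1) / (real k + 2))) \<longlonglongrightarrow> sqrt (2 / pi) / 1"
    by (intro tendsto_divide survival_1_tendsto sqrt_ratio_tendsto_1) simp
  ultimately have "(\<lambda>k. (survival k 1 * sqrt (real k + 1) / sqrt ((real k + 1) / (real k + 2))
      + e k * sqrt (real k + 2)) / 2) \<longlonglongrightarrow> (sqrt (2 / pi) / 1 + 0) / 2"
    by (intro tendsto_divide[OF tendsto_add tendsto_const]) simp_all
  moreover have "(survival k 1 * sqrt (real k + 1) / sqrt ((real k + 1) / (real k + 2)) + e k * sqrt (real k + 2)) / 2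
     = (1 - 1 / (2 * m) - return_prob y z (Suc k) y) * sqrt (real (Suc k) + 1)" for k
  proof -
    have "hit_prob y z k (y + 1) = 1 - survival k 1"
      using hit_prob_survival_above[of z y "y + 1" k] assms by simp
    then have tail: "1 - 1 / (2 * m) - return_prob y z (Suc k) y = (survival k 1 + e k) / 2"
      by (simp add: e_def field_simps)
    have "sqrt (real k + 1) / sqrt ((real k + 1) / (real k + 2)) = sqrt (real k + 2)"
      by (simp add: real_sqrt_divide)
    then have ratio: "survival k 1 * sqrt (real k + 1) / sqrt ((real k + 1) / (real k + 2)) = survival k 1 * sqrt (real k + 2)"
      by (metis times_divide_eq_right)
    have "real (Suc k) + 1 = real k + 2" by simp
    then show ?thesis unfolding tail ratio by (simp only: distrib_right times_divide_eq_left)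
  qed
  ultimately show "(\<lambda>k. (1 - 1 / (2 * real_of_int (y - z)) - return_prob y z (Suc k) y) * sqrt (real (Suc k) + 1))
    \<longlonglongrightarrow> sqrt (2 / pi) / 2"
    by (simp add: m_def)
qed

lemma return_prob_geometric_between:
  assumes "z < x" "x < y"
  defines "m \<equiv> real_of_int (y - z)"
  shows "\<bar>real_of_int (x - z) / m - return_prob y z k x\<bar> \<le> m\<^sup>2 * (1 - 1 / (2 * m\<^sup>2)) ^ k"
proof -
  have "(x - z) * (y - x) \<le> (y - z) * (y - z)" using assms by (intro mult_mono) auto
  then have "real_of_int ((x - z) * (y - x)) \<le> m\<^sup>2"
    unfolding m_def power2_eq_square of_int_mult[symmetric] by (simp only: of_int_le_iff)
  moreover have "1 \<le> m" using assms by (simp add: m_def)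
  then have "0 \<le> 1 - 1 / (2 * m\<^sup>2)" using ruin_rate_bounds(1)[of m] by linarith
  ultimately have "real_of_int ((x - z) * (y - x)) * (1 - 1 / (2 * m\<^sup>2)) ^ k \<le> m\<^sup>2 * (1 - 1 / (2 * m\<^sup>2)) ^ k"
    by (intro mult_right_mono zero_le_power)
  then show ?thesis
    using gambler_ruin_error[of z y x k] assms by (auto simp: return_prob_eq_hit_prob)
qed

text \<open>Only the first step to \<open>z + 1\<close> can lead to \<open>y\<close>; from there the
  ruin probability is \<open>1 / m\<close>, halved by the first step.\<close>

lemma return_prob_geometric_from_avoided:
  assumes "z < y"
  defines "m \<equiv> real_of_int (y - z)"
  shows "\<bar>1 / (2 * m) - return_prob y z k z\<bar> \<le> m\<^sup>2 * (1 - 1 / (2 * m\<^sup>2)) ^ k"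
proof (cases k)
  case 0
  have "1 \<le> m" using assms by (simp add: m_def)
  then have "1 / (2 * m) \<le> 1" "1 \<le> m\<^sup>2" by simp_all
  then have "1 / (2 * m) \<le> m\<^sup>2" by (rule order_trans)
  then show ?thesis using 0 \<open>1 \<le> m\<close> by simp
next
  case (Suc n)
  have m1: "1 \<le> m" using assms by (simp add: m_def)
  define q where "q = 1 - 1 / (2 * m\<^sup>2)"
  have q: "1 / 2 \<le> q" unfolding q_def using m1 by (rule ruin_rate_bounds)
  have "hit_prob y z n (z - 1) = 0" using assms by (simp add: hit_prob_behind)
  then have "1 / (2 * m) - return_prob y z k z = (real_of_int (z + 1 - z) / m - hit_prob y z n (z + 1)) / 2"
    using Suc by (simp add: field_simps)
  moreover have "0 \<le> real_of_int (z + 1 - z) / m - hit_prob y z n (z + 1)"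
     "real_of_int (z + 1 - z) / m - hit_prob y z n (z + 1) \<le> (m - 1) * q ^ n"
    using gambler_ruin_error[of z y "z + 1" n] assms unfolding q_def m_def by (auto simp: algebra_simps)
  ultimately have "\<bar>1 / (2 * m) - return_prob y z k z\<bar> \<le> ((m - 1) * q ^ n) / 2" by simp
  also have "\<dots> \<le> m\<^sup>2 * q ^ n * (1 / 2)"
  proof -
    have "m - 1 \<le> m\<^sup>2" using m1 mult_left_mono[OF m1, of m] unfolding power2_eq_square mult_1_right by linarith
    then have "(m - 1) * q ^ n \<le> m\<^sup>2 * q ^ n" using q by (intro mult_right_mono) auto
    then show ?thesis by simp
  qed
  \<comment> \<open>The factor \<open>1 / 2\<close> of the first step is traded for the missing
    power of \<open>q\<close>, which is possible as \<open>q\<close> is at least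
    \<open>1 / 2\<close>.\<close>
  also have "\<dots> \<le> m\<^sup>2 * q ^ n * q" using q by (intro mult_left_mono) auto
  finally show ?thesis by (simp add: Suc q_def mult_ac)
qed

lemma pois_mixture_asymptotics:
  fixes x y z :: int
  assumes "0 < a" "z < y"
    and H: "\<And>t. 0 \<le> t \<Longrightarrow> (\<lambda>k. pois (a * t) k * return_prob y z k x) sums H t"
  defines "\<epsilon> \<equiv> 1 / (4 * (real_of_int (y - z))\<^sup>2)"
  shows "y < x \<Longrightarrow> (\<lambda>t. 1 - H t) \<sim>[at_top] (\<lambda>t. sqrt 2 * \<bar>real_of_int (y - x)\<bar> / (sqrt (a * pi) * sqrt t))"
    and "x = y \<Longrightarrow> (\<lambda>t. 1 - 1 / (2 * \<bar>real_of_int (y - z)\<bar>) - H t) \<sim>[at_top]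
       (\<lambda>t. 1 / (sqrt (2 * a * pi) * sqrt t))"
    and "z < x \<Longrightarrow> x < y \<Longrightarrow>
       (\<lambda>t. real_of_int (x - z) / real_of_int (y - z) - H t) \<in> o[at_top](\<lambda>t. exp (- a * \<epsilon> * t))"
    and "x = z \<Longrightarrow> (\<lambda>t. 1 / (2 * \<bar>real_of_int (y - z)\<bar>) - H t) \<in> o[at_top](\<lambda>t. exp (- a * \<epsilon> * t))"
    and "x < z \<Longrightarrow> 0 \<le> t \<Longrightarrow> H t = 0"
proof -
  define m where "m = real_of_int (y - z)"
  have m: "\<bar>real_of_int (y - z)\<bar> = m" "1 \<le> m" using assms(2) by (simp_all add: m_def)
  then have \<epsilon>: "\<epsilon> < 1 - (1 - 1 / (2 * m\<^sup>2))"
    unfolding \<epsilon>_def m_def[symmetric] by (simp add: field_simps)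
  show "(\<lambda>t. 1 - H t) \<sim>[at_top] (\<lambda>t. sqrt 2 * \<bar>real_of_int (y - x)\<bar> / (sqrt (a * pi) * sqrt t))" if "y < x"
  proof -
    have "(\<lambda>t. 1 - H t) \<sim>[at_top] (\<lambda>t. (real_of_int (x - y) * sqrt (2 / pi)) / (sqrt a * sqrt t))"
      using that by (intro pois_mixture_asymp_equiv[OF assms(1) H return_prob_tail_above[OF assms(2) that]]) auto
    then show ?thesis using that by (simp add: real_sqrt_mult real_sqrt_divide mult_ac)
  qed
  show "(\<lambda>t. 1 - 1 / (2 * \<bar>real_of_int (y - z)\<bar>) - H t) \<sim>[at_top]
       (\<lambda>t. 1 / (sqrt (2 * a * pi) * sqrt t))" if "x = y"
  proof -
    have "(\<lambda>t. 1 - 1 / (2 * real_of_int (y - z)) - H t) \<sim>[at_top] (\<lambda>t. (sqrt (2 / pi) / 2) / (sqrt a * sqrt t))"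
      using pois_mixture_asymp_equiv[OF assms(1) H[unfolded that] return_prob_tail_from_target[OF assms(2)]] by simp
    moreover have "sqrt (2 / pi) / 2 / (sqrt a * sqrt t) = 1 / (sqrt (2 * a * pi) * sqrt t)" for t
    proof -
      have "sqrt (2 / pi) / 2 = 1 / (sqrt 2 * sqrt pi)"
        by (simp add: real_sqrt_divide field_simps)
      then show ?thesis by (simp add: real_sqrt_mult mult_ac)
    qed
    ultimately show ?thesis using assms(2) by simp
  qed
  show "(\<lambda>t. real_of_int (x - z) / real_of_int (y - z) - H t) \<in> o[at_top](\<lambda>t. exp (- a * \<epsilon> * t))"
    if "z < x" "x < y"
    by (rule pois_mixture_exponential[OF assms(1) H return_prob_geometric_between[OF that]])
       (use \<epsilon> m_def in auto)
  show "(\<lambda>t. 1 / (2 * \<bar>real_of_int (y - z)\<bar>) - H t) \<in> o[at_top](\<lambda>t. exp (- a * \<epsilon> * t))" if "x = z"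
    unfolding m(1)
    by (rule pois_mixture_exponential[OF assms(1) H[unfolded that]
          return_prob_geometric_from_avoided[OF assms(2), folded m_def]])
       (use \<epsilon> in auto)
  show "H t = 0" if "x < z" "0 \<le> t"
    using H[OF that(2)] that assms(2) by (simp add: return_prob_behind sums_iff)
qed

theorem theorem2:
  fixes M :: "'a measure" and a :: real
    and E :: "nat \<Rightarrow> 'a \<Rightarrow> real" and xi :: "nat \<Rightarrow> 'a \<Rightarrow> int"
    and x y z :: int
  assumes "prob_space M" and "0 < a"
    and "\<And>k. distributed M lborel (E k) (\<lambda>s. ennreal (exponential_density a s))"
    and "\<And>k. xi k \<in> measurable M (count_space UNIV)"
    and "\<And>k. measure M {\<omega> \<in> space M. xi k \<omega> = 1} = 1/2"
    and "\<And>k. measure M {\<omega> \<in> space M. xi k \<omega> = -1} = 1/2"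
    and "prob_space.indep_vars M (\<lambda>_. borel)
           (\<lambda>i. case i of Inl k \<Rightarrow> E k | Inr k \<Rightarrow> (\<lambda>\<omega>. real_of_int (xi k \<omega>)))
           (UNIV :: (nat + nat) set)"
    and "y \<noteq> z"
  defines "H \<equiv> H_fun M (srw_pos x E xi) y z"
  shows "\<exists>\<epsilon>. 0 < \<epsilon> \<and> \<epsilon> < 1 \<and>
    ((x < y \<and> y < z \<or> z < y \<and> y < x) \<longrightarrow>
       (\<lambda>t. 1 - H t) \<sim>[at_top]
       (\<lambda>t. sqrt 2 * \<bar>real_of_int (y - x)\<bar> / (sqrt (a * pi) * sqrt t))) \<and>
    (x = y \<longrightarrow>
       (\<lambda>t. 1 - 1 / (2 * \<bar>real_of_int (y - z)\<bar>) - H t) \<sim>[at_top]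
       (\<lambda>t. 1 / (sqrt (2 * a * pi) * sqrt t))) \<and>
    ((z < x \<and> x < y \<or> y < x \<and> x < z) \<longrightarrow>
       (\<lambda>t. real_of_int (x - z) / real_of_int (y - z) - H t) \<in> o[at_top](\<lambda>t. exp (- a * \<epsilon> * t))) \<and>
    (x = z \<longrightarrow>
       (\<lambda>t. 1 / (2 * \<bar>real_of_int (y - z)\<bar>) - H t) \<in> o[at_top](\<lambda>t. exp (- a * \<epsilon> * t))) \<and>
    ((x < z \<and> z < y \<or> y < z \<and> z < x) \<longrightarrow> (\<forall>t\<ge>0. H t = 0))"
proof -
  interpret exponential_walk M a E xi
    using assms(1-7) by (simp add: exponential_walk_def exponential_walk_axioms_def)
  note sums = H_fun_sums[OF _ \<open>y \<noteq> z\<close>, of _ x, folded H_def]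
  define \<epsilon> where "\<epsilon> = 1 / (4 * (real_of_int (y - z))\<^sup>2)"
  have "1 \<le> (y - z)\<^sup>2" using \<open>y \<noteq> z\<close> by (simp add: int_one_le_iff_zero_less)
  then have "1 \<le> (real_of_int (y - z))\<^sup>2" by (metis of_int_1 of_int_le_iff of_int_power)
  then have \<epsilon>: "0 < \<epsilon>" "\<epsilon> < 1" unfolding \<epsilon>_def by (simp_all only: divide_simps) auto
  show ?thesis
  proof (cases "z < y")
    case True
    note * = pois_mixture_asymptotics[OF \<open>0 < a\<close> True sums, folded \<epsilon>_def]
    from True show ?thesis
      by (intro exI[of _ \<epsilon>] conjI impI allI \<epsilon> *) (simp_all, linarith+)
  next
    case False
    then have neg: "- z < - y" using \<open>y \<noteq> z\<close> by simp
    have "(\<lambda>k. pois (a * t) k * return_prob (- y) (- z) k (- x)) sums H t" if "0 \<le> t" for t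
      using sums[OF that] by (simp add: return_prob_reflect)
    note * = pois_mixture_asymptotics[OF \<open>0 < a\<close> neg this]
    \<comment> \<open>The mirrored triple has the same distances and the same ratio, so the claims
      for it are literally those for \<open>x\<close>, \<open>y\<close>, \<open>z\<close>.\<close>
    have eqs: "(real_of_int (- y - - z))\<^sup>2 = (real_of_int (y - z))\<^sup>2"
      "\<bar>real_of_int (- y - - z)\<bar> = \<bar>real_of_int (y - z)\<bar>"
      "\<bar>real_of_int (- y - - x)\<bar> = \<bar>real_of_int (y - x)\<bar>"
      "real_of_int (- x - - z) / real_of_int (- y - - z) = real_of_int (x - z) / real_of_int (y - z)"
      using minus_divide_divide[of "real_of_int (x - z)" "real_of_int (y - z)"]
      by (simp_all add: power2_commute abs_minus_commute)
    note ** = *[unfolded eqs, folded \<epsilon>_def]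
    from neg show ?thesis
      by (intro exI[of _ \<epsilon>] conjI impI allI \<epsilon> **) (simp_all, linarith+)
  qed
qed

end
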